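(* Let $k$ be an algebraically closed field of characteristic $0$, and let $(R,\mathfrak{m}_R,k)$ be a one-dimensional complete equicharacteristic local $k$-algebra which is a domain, with embedding dimension $n\geq 2$. Let $\mathfrak{C}_R$ be the conductor of $R$ in its integral closure. If $\mathfrak{C}_R\not\subseteq \mathfrak{m}_R^2$, then the torsion submodule $\tau(\Omega_R)$ is nonzero.
   Context: $R$ has residue field $k$. Its integral closure in its fraction field $Q$ is $\overline{R}=k[[t]]$. The embedding dimension $n$ is the minimal number of generators of $\mathfrak{m}_R$. The conductor is $\mathfrak{C}_R=\{q\in Q: q\overline{R}\subseteq R\}$. Write $R=k[[X_1,\dots,X_n]]/I$ with $I=(f_1,\dots,f_m)\subseteq (X_1,\dots,X_n)^2$, and let $x_i$ be the image of $X_i$. The universally finite module of differentials $\Omega_R$ of $R$ over $k$ is the cokernel of the Jacobian matrix $R^m\xrightarrow{[\partial f_j/\partial x_i]}R^n$ (entries in $R$). Its torsion submodule (elements annihilated by a nonzero element of $R$) is denoted $\tau(\Omega_R)$. *)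

theory Defs
  imports
    "HOL-Analysis.Cartesian_Space"
    "HOL-Computational_Algebra.Polynomial_Factorial"
    "HOL-Library.Extended_Nat"
    "HOL-Library.Set_Algebras"
begin

section \<open>Ideals and local rings\<close>

text \<open>
  Rings are types of class \<^class>\<open>comm_ring_1\<close>. Ideals are the submodules of the
  ring, viewed as a module over itself.
\<close>

abbreviation is_ideal :: "'a::comm_ring_1 set \<Rightarrow> bool"
  where "is_ideal \<equiv> module.subspace (*)"

abbreviation ideal_gen :: "'a::comm_ring_1 set \<Rightarrow> 'a set"
  where "ideal_gen \<equiv> module.span (*)"

lemma module_times: "module ((*) :: 'a::comm_ring_1 \<Rightarrow> 'a \<Rightarrow> 'a)"
  by unfold_locales (simp_all add: algebra_simps)

definition ideal_prod :: "'a::comm_ring_1 set \<Rightarrow> 'a set \<Rightarrow> 'a set"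
  where "ideal_prod I J = ideal_gen {a * b |a b. a \<in> I \<and> b \<in> J}"

primrec ideal_power :: "'a::comm_ring_1 set \<Rightarrow> nat \<Rightarrow> 'a set"
  where
    "ideal_power I 0 = UNIV"
  | "ideal_power I (Suc n) = ideal_prod I (ideal_power I n)"

definition prime_ideal :: "'a::comm_ring_1 set \<Rightarrow> bool"
  where "prime_ideal P \<longleftrightarrow>
    is_ideal P \<and> P \<noteq> UNIV \<and> (\<forall>x y. x * y \<in> P \<longrightarrow> x \<in> P \<or> y \<in> P)"

definition maximal_ideal :: "'a::comm_ring_1 set \<Rightarrow> bool"
  where "maximal_ideal M \<longleftrightarrow>
    is_ideal M \<and> M \<noteq> UNIV \<and> (\<forall>J. is_ideal J \<and> M \<subseteq> J \<longrightarrow> J = M \<or> J = UNIV)"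

definition noetherian :: "'a::comm_ring_1 itself \<Rightarrow> bool"
  where "noetherian _ \<longleftrightarrow> (\<forall>I::'a set. is_ideal I \<longrightarrow> (\<exists>S. finite S \<and> I = ideal_gen S))"

text \<open>As usual, local rings are required to be Noetherian; \<open>M\<close> is the maximal ideal.\<close>

definition local_ring :: "'a::comm_ring_1 set \<Rightarrow> bool"
  where "local_ring M \<longleftrightarrow> noetherian TYPE('a) \<and> (\<forall>N. maximal_ideal N \<longleftrightarrow> N = M)"

text \<open>
  Completeness says that the canonical map from the ring to the inverse limit of the
  quotients by the powers of \<open>M\<close> is bijective. An element of the inverse limit is
  represented by a sequence of lifts of its components.
\<close>

definition adically_complete :: "'a::comm_ring_1 set \<Rightarrow> bool"
  where "adically_complete M \<longleftrightarrow>
    (\<Inter>i. ideal_power M i) = {0} \<and>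
    (\<forall>s. (\<forall>i. s (Suc i) - s i \<in> ideal_power M i) \<longrightarrow>
         (\<exists>l. \<forall>i. l - s i \<in> ideal_power M i))"

definition krull_dim :: "'a::comm_ring_1 itself \<Rightarrow> enat"
  where "krull_dim _ =
    Sup {enat n |n. \<exists>P::nat \<Rightarrow> 'a set.
           (\<forall>i\<le>n. prime_ideal (P i)) \<and> (\<forall>i<n. P i \<subset> P (Suc i))}"

definition emb_dim :: "'a::comm_ring_1 set \<Rightarrow> nat"
  where "emb_dim M = (LEAST n. \<exists>S. finite S \<and> card S = n \<and> ideal_gen S = M)"

definition is_ring_hom :: "('a::comm_ring_1 \<Rightarrow> 'b::comm_ring_1) \<Rightarrow> bool"
  where "is_ring_hom h \<longleftrightarrow>
    h 1 = 1 \<and> (\<forall>x y. h (x + y) = h x + h y) \<and> (\<forall>x y. h (x * y) = h x * h y)"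

text \<open>
  The structure map \<open>\<iota>\<close> from the field induces an isomorphism onto the residue field:
  every residue class modulo \<open>M\<close> contains the image of exactly one scalar.
\<close>

definition has_residue_field :: "('k::field \<Rightarrow> 'a::comm_ring_1) \<Rightarrow> 'a set \<Rightarrow> bool"
  where "has_residue_field \<iota> M \<longleftrightarrow> is_ring_hom \<iota> \<and> (\<forall>r. \<exists>!c. r - \<iota> c \<in> M)"


section \<open>Integral closure and conductor of a domain\<close>

definition integral_closure :: "'a::idom fract set"
  where "integral_closure =
    {q. \<exists>p::'a poly. lead_coeff p = 1 \<and> poly (map_poly to_fract p) q = 0}"

definition conductor :: "'a::idom fract set"
  where "conductor = {q. \<forall>s\<in>integral_closure. q * s \<in> range to_fract}"


section \<open>Formal power series in several variables\<close>

text \<open>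
  The variables are indexed by a finite type \<open>'n\<close>. A power series is the family of its
  coefficients, indexed by the exponent vectors.
\<close>

typedef ('n, 'k) mfps = "UNIV :: (('n \<Rightarrow> nat) \<Rightarrow> 'k) set"
  morphisms mfps_coeff Abs_mfps ..

lemma mfps_coeff_Abs [simp]: "mfps_coeff (Abs_mfps f) = f"
  by (simp add: Abs_mfps_inverse)

lemma mfps_eqI: "(\<And>e. mfps_coeff f e = mfps_coeff g e) \<Longrightarrow> f = g"
  by (metis mfps_coeff_inject ext)

lemma finite_atMost_exponent [simp]: "finite {..e :: 'n::finite \<Rightarrow> nat}"
proof -
  have "{..e} = (\<Pi>\<^sub>E i\<in>UNIV. {..e i})"
    by (auto simp: le_fun_def PiE_def Pi_def extensional_def)
  then show ?thesis
    by (simp add: finite_PiE)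
qed

instantiation mfps :: (finite, comm_ring_1) comm_ring_1
begin

definition "0 = Abs_mfps (\<lambda>_. 0)"
definition "1 = Abs_mfps (\<lambda>e. if e = (\<lambda>_. 0) then 1 else 0)"
definition "f + g = Abs_mfps (\<lambda>e. mfps_coeff f e + mfps_coeff g e)"
definition "- f = Abs_mfps (\<lambda>e. - mfps_coeff f e)"
definition "f - g = Abs_mfps (\<lambda>e. mfps_coeff f e - mfps_coeff g e)"
definition "f * g = Abs_mfps (\<lambda>e. \<Sum>a\<in>{..e}. mfps_coeff f a * mfps_coeff g (e - a))"

instance
proof
  fix f g h :: "('a, 'b) mfps"
  show "f + g + h = f + (g + h)" "f + g = g + f" "0 + f = f" "- f + f = 0" "f - g = f + - g"
    by (auto intro!: mfps_eqI simp: plus_mfps_def zero_mfps_def uminus_mfps_def minus_mfps_def)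
  show "(f + g) * h = f * h + g * h"
    by (auto intro!: mfps_eqI simp: plus_mfps_def times_mfps_def algebra_simps sum.distrib)
  show "(0::('a, 'b) mfps) \<noteq> 1"
  proof
    assume "(0::('a, 'b) mfps) = 1"
    then have "mfps_coeff (0::('a, 'b) mfps) (\<lambda>_. 0) = mfps_coeff 1 (\<lambda>_. 0)"
      by (rule arg_cong)
    then show False
      by (simp add: zero_mfps_def one_mfps_def)
  qed
  show "f * g = g * f"
  proof (rule mfps_eqI)
    fix e
    show "mfps_coeff (f * g) e = mfps_coeff (g * f) e"
      unfolding times_mfps_def mfps_coeff_Abs
      by (rule sum.reindex_bij_witness[where i = "\<lambda>a. e - a" and j = "\<lambda>a. e - a"])
         (auto simp: le_fun_def fun_eq_iff mult.commute fun_diff_def)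
  qed
  show "1 * f = f"
  proof (rule mfps_eqI)
    fix e
    have "mfps_coeff (1 * f) e =
      (\<Sum>a\<in>{..e}. if a = (\<lambda>_. 0) then mfps_coeff f (e - a) else 0)"
      unfolding times_mfps_def one_mfps_def mfps_coeff_Abs by (rule sum.cong) auto
    also have "\<dots> = mfps_coeff f (e - (\<lambda>_. 0))"
      by (subst sum.delta) (auto simp: le_fun_def)
    also have "e - (\<lambda>_. 0) = e"
      by (simp add: fun_eq_iff fun_diff_def)
    finally show "mfps_coeff (1 * f) e = mfps_coeff f e" .
  qed
  show "f * g * h = f * (g * h)"
  proof (rule mfps_eqI)
    fix e
    let ?F = "mfps_coeff f" and ?G = "mfps_coeff g" and ?H = "mfps_coeff h"
    have "mfps_coeff (f * g * h) e = (\<Sum>a\<in>{..e}. \<Sum>b\<in>{..a}. ?F b * ?G (a - b) * ?H (e - a))"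
      by (simp add: times_mfps_def sum_distrib_right)
    also have "\<dots> = (\<Sum>(a, b)\<in>Sigma {..e} (\<lambda>a. {..a}). ?F b * ?G (a - b) * ?H (e - a))"
      by (simp add: sum.Sigma)
    also have "\<dots> = (\<Sum>(b, c)\<in>Sigma {..e} (\<lambda>b. {..e - b}). ?F b * (?G c * ?H (e - b - c)))"
    proof (rule sum.reindex_bij_witness[where i = "\<lambda>(b, c). (\<lambda>i. b i + c i, b)"
          and j = "\<lambda>(a, b). (b, a - b)"], goal_cases)
      case (1 p)
      then show ?case
        by (auto simp: le_fun_def fun_eq_iff fun_diff_def)
    next
      case (2 p)
      then obtain a b where p: "p = (a, b)" and le: "a i \<le> e i" "b i \<le> a i" for i
        by (auto simp: le_fun_def)
      have "b i \<le> e i" "a i - b i \<le> e i - b i" for i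
        using le[of i] by linarith+
      then show ?case
        by (simp add: p le_fun_def fun_diff_def)
    next
      case (3 q)
      then show ?case
        by (auto simp: fun_eq_iff fun_diff_def)
    next
      case (4 q)
      then obtain b c where q: "q = (b, c)" and le: "b i \<le> e i" "c i \<le> e i - b i" for i
        by (auto simp: le_fun_def fun_diff_def)
      have "b i + c i \<le> e i" for i
        using le[of i] by linarith
      then show ?case
        by (simp add: q le_fun_def)
    next
      case (5 p)
      then obtain a b where p: "p = (a, b)" and le: "b i \<le> a i" for i
        by (auto simp: le_fun_def)
      have "e i - b i - (a i - b i) = e i - a i" for i
        using le[of i] by linarith
      then have "e - b - (a - b) = e - a"
        by (simp add: fun_eq_iff fun_diff_def)
      then show ?case
        by (simp add: p mult.assoc)
    qed
    also have "\<dots> = (\<Sum>b\<in>{..e}. \<Sum>c\<in>{..e - b}. ?F b * (?G c * ?H (e - b - c)))"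
      by (simp add: sum.Sigma)
    also have "\<dots> = mfps_coeff (f * (g * h)) e"
      by (simp add: times_mfps_def sum_distrib_left)
    finally show "mfps_coeff (f * g * h) e = mfps_coeff (f * (g * h)) e" .
  qed
qed

end

definition mfps_const :: "'k::zero \<Rightarrow> ('n, 'k) mfps"
  where "mfps_const c = Abs_mfps (\<lambda>e. if e = (\<lambda>_. 0) then c else 0)"

definition mfps_X :: "'n \<Rightarrow> ('n, 'k::zero_neq_one) mfps"
  where "mfps_X i = Abs_mfps (\<lambda>e. if e = (\<lambda>j. if j = i then 1 else 0) then 1 else 0)"

definition mfps_pderiv :: "'n \<Rightarrow> ('n, 'k::semiring_1) mfps \<Rightarrow> ('n, 'k) mfps"
  where "mfps_pderiv i f =
    Abs_mfps (\<lambda>e. of_nat (Suc (e i)) * mfps_coeff f (e(i := Suc (e i))))"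


section \<open>Presentations and differentials\<close>

text \<open>
  \<open>\<phi>\<close> identifies the \<open>k\<close>-algebra \<open>'r\<close> (with structure map \<open>\<iota>\<close>) with the quotient of the
  power series ring by the ideal generated by the components of \<open>f\<close>. The index type of \<open>f\<close>
  is nonempty, which is no restriction since the zero ideal is generated by \<open>0\<close>.
\<close>

definition presentation ::
    "('k::field \<Rightarrow> 'r::comm_ring_1) \<Rightarrow> (('n::finite, 'k) mfps \<Rightarrow> 'r) \<Rightarrow>
     (('n, 'k) mfps) ^ 'm \<Rightarrow> bool"
  where "presentation \<iota> \<phi> f \<longleftrightarrow>
    is_ring_hom \<phi> \<and> (\<forall>c. \<phi> (mfps_const c) = \<iota> c) \<and> surj \<phi> \<and>
    {F. \<phi> F = 0} = ideal_gen (range (($) f))"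

definition jacobian ::
    "(('n::finite, 'k::field) mfps \<Rightarrow> 'r::comm_ring_1) \<Rightarrow> (('n, 'k) mfps) ^ 'm::finite \<Rightarrow> 'r ^ 'm ^ 'n"
  where "jacobian \<phi> f = (\<chi> i j. \<phi> (mfps_pderiv i (f $ j)))"

text \<open>
  The cokernel of \<open>A : R\<^sup>m \<rightarrow> R\<^sup>n\<close>, as the set of cosets of the image of \<open>A\<close>. The zero
  element is the image itself; \<open>r\<close> times the coset of \<open>v\<close> is the coset of \<open>r *s v\<close>.
\<close>

definition cokernel :: "'r::comm_ring_1 ^ 'm ^ 'n \<Rightarrow> ('r ^ 'n) set set"
  where "cokernel A = range (\<lambda>v. v +o range ((*v) A))"

definition coker_zero :: "'r::comm_ring_1 ^ 'm ^ 'n \<Rightarrow> ('r ^ 'n) set"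
  where "coker_zero A = range ((*v) A)"

definition coker_scale :: "'r::comm_ring_1 ^ 'm ^ 'n \<Rightarrow> 'r \<Rightarrow> ('r ^ 'n) set \<Rightarrow> ('r ^ 'n) set"
  where "coker_scale A r C = (\<Union>v\<in>C. (r *s v) +o range ((*v) A))"

lemma coker_scale_coset:
  fixes A :: "'r::comm_ring_1 ^ 'm ^ 'n"
  shows "coker_scale A r (v +o range ((*v) A)) = (r *s v) +o range ((*v) A)"
proof -
  have scale: "r *s (v + A *v x) + A *v z = r *s v + A *v (r *s x + z)" for x z
    by (simp add: matrix_vector_mult_def vec_eq_iff vector_scalar_mult_def
          sum.distrib sum_distrib_left algebra_simps)
  show ?thesis
  proof (rule set_eqI, rule iffI)
    fix w
    assume "w \<in> coker_scale A r (v +o range ((*v) A))"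
    then obtain x z where "w = r *s (v + A *v x) + A *v z"
      by (auto simp: coker_scale_def elt_set_plus_def)
    then show "w \<in> (r *s v) +o range ((*v) A)"
      unfolding scale by (auto simp: elt_set_plus_def)
  next
    fix w
    assume "w \<in> (r *s v) +o range ((*v) A)"
    moreover have "v \<in> v +o range ((*v) A)"
      by (auto simp: elt_set_plus_def intro!: exI[of _ 0])
    ultimately show "w \<in> coker_scale A r (v +o range ((*v) A))"
      unfolding coker_scale_def by blast
  qed
qed

definition coker_torsion :: "'r::comm_ring_1 ^ 'm ^ 'n \<Rightarrow> ('r ^ 'n) set set"
  where "coker_torsion A = {\<omega> \<in> cokernel A. \<exists>r. r \<noteq> 0 \<and> coker_scale A r \<omega> = coker_zero A}"

end

theory Submission
  imports Defs
begin

text \<open>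
  The integral closure \<open>B\<close> of \<open>R\<close> is \<open>k[[t]]\<close>; extracting an \<open>e\<close>-th root of a unit (Hensel), we can choose
  the uniformizer with \<open>t\<^sup>e \<in> R\<close>, where \<open>e\<close> is the multiplicity of \<open>R\<close>. Let \<open>y = t\<^sup>e\<close>, and let the
  conductor be \<open>C = t\<^sup>c B\<close>. Since \<open>t\<^sup>e C \<subseteq> \<mm>\<^sup>2\<close>, and \<open>C\<close> is not contained in \<open>\<mm>\<^sup>2\<close>, there is some
  \<open>x = t\<^sup>v \<in> C\<close> outside \<open>\<mm>\<^sup>2\<close>, and taking \<open>v\<close> maximal makes \<open>x\<close> and \<open>y\<close> linearly independent
  modulo \<open>\<mm>\<^sup>2\<close>. Then \<open>e y dx - v x dy\<close> is a torsion element because \<open>x\<^sup>e = y\<^sup>v\<close>, and it does not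
  vanish because, to first order, it is not the differential of a quadratic form (\<open>e \<noteq> - v\<close>).

  Integrality over a Noetherian domain is used in the form "\<open>s q\<^sup>n \<in> R\<close> for all \<open>n\<close>, for some
  \<open>s \<noteq> 0\<close>", and a nonzero element \<open>x0\<close> of the conductor embeds \<open>B\<close> as an ideal of \<open>R\<close>; so
  finiteness and completeness of \<open>B\<close> come for free.
\<close>

section \<open>Ideals and integral elements\<close>

text \<open>For x = t^v and y = t^e the form e y dx - v x dy vanishes among the differentials of
  k[[t]]; this is where its coefficients come from. Having y equal to a pure power of t turns the
  coincidence into the equation \<open>x ^ e = y ^ v\<close> inside R, which can be differentiated
  in the presentation. The obstacle is that no parameter t is given: B is only the set of integral
  fractions, and its valuation has to be built. Convergence in B is measured by powers of a fixed
  nonzero element of the maximal ideal. Locality of B comes from lifting idempotents, and a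
  uniformizer from a socle element of B modulo that fixed element, as in the classical proof that an
  integrally closed local domain of dimension one is a discrete valuation ring. No isomorphism with
  k[[t]] is constructed: factorization into a unit times a power of t, together with B = k + t B, is
  enough for the choice of x and y.\<close>

interpretation idl: module "(*) :: 'a::comm_ring_1 \<Rightarrow> 'a \<Rightarrow> 'a"
  by (rule module_times)

declare idl.scale_scale [simp del] \<comment> \<open>reverses and loops with \<open>mult.assoc\<close>\<close>

text \<open>The union of a chain of ideals is finitely generated, and its generators already lie in
  one member. The union is therefore that member, and Zorn's lemma applies inside
  \<open>\<A>\<close>.\<close>

lemma noetherian_maximal:
  fixes \<A> :: "'a::comm_ring_1 set set"
  assumes "noetherian TYPE('a)" "\<A> \<noteq> {}" "\<And>I. I \<in> \<A> \<Longrightarrow> is_ideal I"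
  shows "\<exists>M\<in>\<A>. \<forall>J\<in>\<A>. M \<subseteq> J \<longrightarrow> J = M"
proof (rule subset_Zorn_nonempty[OF assms(2)])
  fix C assume C: "C \<noteq> {}" "subset.chain \<A> C"
  have sub: "C \<subseteq> \<A>" using C(2) by (simp add: subset.chain_def)
  have tot: "c \<subseteq> d \<or> d \<subseteq> c" if "c \<in> C" "d \<in> C" for c d
    using C(2) that by (auto simp: subset_chain_def)
  have "is_ideal (\<Union>C)"
  proof (rule idl.subspaceI)
    show "0 \<in> \<Union>C" using C(1) sub assms(3) idl.subspace_0 by blast
  next
    fix x y assume "x \<in> \<Union>C" "y \<in> \<Union>C"
    then obtain c d where "x \<in> c" "y \<in> d" "c \<in> C" "d \<in> C" by blast
    with tot[of c d] show "x + y \<in> \<Union>C" using assms(3) sub idl.subspace_add by blast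
  next
    fix x y assume "y \<in> \<Union>C"
    then show "x * y \<in> \<Union>C" using assms(3) sub idl.subspace_scale by blast
  qed
  then obtain S where S: "finite S" "\<Union>C = ideal_gen S"
    using assms(1) by (auto simp: noetherian_def)
  have "S \<subseteq> \<Union>C" using S(2) idl.span_superset by metis
  then obtain B where B: "B \<in> C" "S \<subseteq> B"
    by (rule finite_subset_Union_chain[OF S(1) _ C])
  have "\<Union>C \<subseteq> B" unfolding S(2)
    by (rule idl.span_minimal[OF B(2)]) (use B sub assms(3) in blast)
  then have "\<Union>C = B" using B by blast
  then show "\<Union>C \<in> \<A>" using B sub by auto
qed

text \<open>The ideals generated by the initial segments stabilize. For the sequence s q^n the
  resulting relation becomes a monic equation for q.\<close>

lemma noetherian_sequence:
  fixes s :: "nat \<Rightarrow> 'a::comm_ring_1"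
  assumes "noetherian TYPE('a)"
  obtains N c where "s N = (\<Sum>i<N. c i * s i)"
proof -
  define J where "J n = ideal_gen (s ` {..<n})" for n
  have mono: "J m \<subseteq> J n" if "m \<le> n" for m n
    unfolding J_def by (rule idl.span_mono) (use that in auto)
  have "\<exists>M\<in>range J. \<forall>K\<in>range J. M \<subseteq> K \<longrightarrow> K = M"
    by (rule noetherian_maximal[OF assms]) (auto simp: J_def)
  then obtain N where N: "\<forall>K\<in>range J. J N \<subseteq> K \<longrightarrow> K = J N" by auto
  have "s N \<in> J (Suc N)" unfolding J_def by (rule idl.span_base) auto
  then have "s N \<in> J N" using N mono[of N "Suc N"] by auto
  moreover have "J N \<subseteq> {\<Sum>i<N. c i * s i |c. True}" unfolding J_def
  proof (rule idl.span_minimal)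
    show "s ` {..<N} \<subseteq> {\<Sum>i<N. c i * s i |c. True}"
    proof clarify
      fix j assume "j < N"
      then have "s j = (\<Sum>i<N. (if i = j then 1 else 0) * s i)"
        by (simp add: if_distrib[of "\<lambda>x. x * _"] cong: if_cong)
      then show "\<exists>c. s j = (\<Sum>i<N. c i * s i) \<and> True" by (intro exI[of _ "\<lambda>i. if i = j then 1 else 0"]) simp
    qed
  next
    show "is_ideal {\<Sum>i<N. c i * s i |c. True}"
    proof (rule idl.subspaceI)
      show "0 \<in> {\<Sum>i<N. c i * s i |c. True}" by (auto intro!: exI[of _ "\<lambda>_. 0"])
    next
      fix x y assume "x \<in> {\<Sum>i<N. c i * s i |c. True}" "y \<in> {\<Sum>i<N. c i * s i |c. True}"
      then obtain c d where "x = (\<Sum>i<N. c i * s i)" "y = (\<Sum>i<N. d i * s i)" by blast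
      then have "x + y = (\<Sum>i<N. (c i + d i) * s i)" by (simp add: algebra_simps sum.distrib)
      then show "x + y \<in> {\<Sum>i<N. c i * s i |c. True}" by auto
    next
      fix r x assume "x \<in> {\<Sum>i<N. c i * s i |c. True}"
      then obtain c where "x = (\<Sum>i<N. c i * s i)" by blast
      then have "r * x = (\<Sum>i<N. (r * c i) * s i)" by (simp only: sum_distrib_left mult.assoc)
      then show "r * x \<in> {\<Sum>i<N. c i * s i |c. True}" by auto
    qed
  qed
  ultimately show ?thesis using that by blast
qed

lemma is_ideal_colon:
  assumes K: "is_ideal K"
  shows "is_ideal {x. \<forall>y\<in>Y. x * y \<in> K}"
proof (rule idl.subspaceI)
  show "0 \<in> {x. \<forall>y\<in>Y. x * y \<in> K}" by (simp add: idl.subspace_0[OF K])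
next
  fix x z assume "x \<in> {x. \<forall>y\<in>Y. x * y \<in> K}" "z \<in> {x. \<forall>y\<in>Y. x * y \<in> K}"
  then show "x + z \<in> {x. \<forall>y\<in>Y. x * y \<in> K}"
    by (simp add: distrib_right idl.subspace_add[OF K])
next
  fix c x assume "x \<in> {x. \<forall>y\<in>Y. x * y \<in> K}"
  then show "c * x \<in> {x. \<forall>y\<in>Y. x * y \<in> K}"
    by (simp add: mult.assoc idl.subspace_scale[OF K])
qed

text \<open>Bilinear span induction: colon sets are ideals, so each factor in turn can be extended
  from generators to the span.\<close>

lemma ideal_gen_mult:
  assumes "is_ideal K" "\<And>a b. a \<in> A \<Longrightarrow> b \<in> B \<Longrightarrow> a * b \<in> K" "x \<in> ideal_gen A" "y \<in> ideal_gen B"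
  shows "x * y \<in> K"
proof -
  have "ideal_gen A \<subseteq> {x. \<forall>y\<in>ideal_gen B. x * y \<in> K}"
  proof (rule idl.span_minimal)
    show "A \<subseteq> {x. \<forall>y\<in>ideal_gen B. x * y \<in> K}"
    proof clarify
      fix a y assume a: "a \<in> A" and y: "y \<in> ideal_gen B"
      have "ideal_gen B \<subseteq> {y. \<forall>a\<in>{a}. y * a \<in> K}"
        by (rule idl.span_minimal[OF _ is_ideal_colon[OF assms(1)]])
          (simp add: subset_iff mult.commute[of _ a] assms(2)[OF a])
      then have "y * a \<in> K" using y by blast
      then show "a * y \<in> K" by (simp add: mult.commute)
    qed
    show "is_ideal {x. \<forall>y\<in>ideal_gen B. x * y \<in> K}" by (rule is_ideal_colon[OF assms(1)])
  qed
  then show ?thesis using assms by blast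
qed

lemma is_ideal_power: "is_ideal (ideal_power M n)"
  by (cases n) (auto simp: ideal_prod_def)

lemma ideal_power_1:
  assumes M: "is_ideal M"
  shows "ideal_power M 1 = M"
proof -
  have "ideal_prod M UNIV \<subseteq> M" unfolding ideal_prod_def
  proof (rule idl.span_minimal[OF _ M], clarify)
    show "a * b \<in> M" if "a \<in> M" for a b
      using idl.subspace_scale[OF M that, of b] by (simp add: mult.commute)
  qed
  moreover have "M \<subseteq> ideal_prod M UNIV" unfolding ideal_prod_def
  proof (intro subsetI idl.span_base)
    show "a \<in> {a * b |a b. a \<in> M \<and> b \<in> UNIV}" if "a \<in> M" for a
      using that by (metis (mono_tags, lifting) UNIV_I mem_Collect_eq mult_1_right)
  qed
  ultimately show ?thesis by auto
qed

lemma ideal_power_2: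
  "is_ideal M \<Longrightarrow> ideal_power M 2 = ideal_gen {a * b |a b. a \<in> M \<and> b \<in> M}"
  using ideal_power_1[of M] by (simp add: numeral_2_eq_2 ideal_prod_def[of M M])

lemma ideal_power_Suc_subset: "ideal_power M (Suc n) \<subseteq> ideal_power M n"
  unfolding ideal_power.simps ideal_prod_def
  by (rule idl.span_minimal[OF _ is_ideal_power])
    (use idl.subspace_scale[OF is_ideal_power] in auto)

lemma ideal_power_antimono: "m \<le> n \<Longrightarrow> ideal_power M n \<subseteq> ideal_power M m"
  by (rule lift_Suc_antimono_le[of "ideal_power M"]) (rule ideal_power_Suc_subset)

lemma power_in_ideal_power: "x \<in> M \<Longrightarrow> x ^ n \<in> ideal_power M n"
  by (induction n) (auto simp: ideal_prod_def intro!: idl.span_base)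

text \<open>Induction on m with n free: the factor u of a generator u v of M^(n+1) is moved over to
  a, which puts u a into M^(m+1).\<close>

lemma ideal_power_add_subset:
  assumes K: "is_ideal K" and "\<And>a b. a \<in> ideal_power M m \<Longrightarrow> b \<in> ideal_power M n \<Longrightarrow> a * b \<in> K"
  shows "ideal_power M (m + n) \<subseteq> K"
  using assms(2)
proof (induction m arbitrary: n)
  case 0
  then show ?case by (metis UNIV_I add_0 ideal_power.simps(1) mult_1 subsetI)
next
  case (Suc m)
  have "ideal_power M (m + Suc n) \<subseteq> K"
  proof (rule Suc.IH)
    fix a b assume a: "a \<in> ideal_power M m" and b: "b \<in> ideal_power M (Suc n)"
    have "ideal_power M (Suc n) \<subseteq> {b. \<forall>a\<in>{a}. b * a \<in> K}"
      unfolding ideal_power.simps(2) ideal_prod_def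
    proof (rule idl.span_minimal[OF _ is_ideal_colon[OF K]])
      show "{a * b |a b. a \<in> M \<and> b \<in> ideal_power M n} \<subseteq> {b. \<forall>a\<in>{a}. b * a \<in> K}"
      proof clarify
        fix u v assume "u \<in> M" "v \<in> ideal_power M n"
        moreover from this have "u * a \<in> ideal_power M (Suc m)"
          using a by (auto simp: ideal_prod_def intro!: idl.span_base)
        ultimately have "u * a * v \<in> K" using Suc.prems by blast
        then show "u * v * a \<in> K" by (metis mult.assoc mult.commute)
      qed
    qed
    then show "a * b \<in> K" using b by (auto simp: mult.commute)
  qed
  then show ?case by simp
qed

section \<open>Local domains of dimension one\<close>

lemma local_ring_maximal: "local_ring M \<Longrightarrow> maximal_ideal M"
  by (simp add: local_ring_def)

lemma local_ring_noetherian: "local_ring (M :: 'a::comm_ring_1 set) \<Longrightarrow> noetherian TYPE('a)"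
  by (simp add: local_ring_def)

text \<open>The Noetherian property supplies a maximal ideal above I; uniqueness in the definition
  of a local ring identifies it with M.\<close>

lemma local_ring_contains:
  fixes M :: "'a::comm_ring_1 set"
  assumes "local_ring M" "is_ideal I" "I \<noteq> UNIV"
  shows "I \<subseteq> M"
proof -
  define \<A> where "\<A> = {J. is_ideal J \<and> I \<subseteq> J \<and> J \<noteq> UNIV}"
  have "\<exists>N\<in>\<A>. \<forall>J\<in>\<A>. N \<subseteq> J \<longrightarrow> J = N"
  proof (rule noetherian_maximal[OF local_ring_noetherian[OF assms(1)]])
    show "\<A> \<noteq> {}" using assms(2,3) by (auto simp: \<A>_def)
  qed (simp add: \<A>_def)
  then obtain N where N: "N \<in> \<A>" "\<And>J. J \<in> \<A> \<Longrightarrow> N \<subseteq> J \<Longrightarrow> J = N" by blast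
  have "J = N \<or> J = UNIV" if "is_ideal J" "N \<subseteq> J" for J
    using N that by (cases "J = UNIV") (auto simp: \<A>_def)
  then have "maximal_ideal N" using N(1) by (auto simp: maximal_ideal_def \<A>_def)
  then show ?thesis using assms(1) N(1) by (auto simp: local_ring_def \<A>_def)
qed

lemma maximal_ideal_prime:
  assumes "maximal_ideal M"
  shows "prime_ideal M"
proof -
  have M: "is_ideal M" "M \<noteq> UNIV" using assms by (auto simp: maximal_ideal_def)
  have "x \<in> M \<or> y \<in> M" if xy: "x * y \<in> M" for x y
  proof (rule ccontr)
    assume n: "\<not> (x \<in> M \<or> y \<in> M)"
    have "M \<subseteq> ideal_gen (insert x M)" using idl.span_superset by blast
    moreover have "x \<in> ideal_gen (insert x M)" by (rule idl.span_base) simp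
    ultimately have "ideal_gen (insert x M) = UNIV" using assms n
      by (auto simp: maximal_ideal_def)
    then obtain k where k: "1 - k * x \<in> M"
      using idl.span_breakdown_eq[of 1 x M] M(1) idl.span_eq_iff by (metis UNIV_I)
    have "y = y * (1 - k * x) + k * (x * y)" by (simp add: algebra_simps)
    also have "\<dots> \<in> M" by (intro idl.subspace_add idl.subspace_scale M k xy)
    finally show False using n by simp
  qed
  then show ?thesis using M by (auto simp: prime_ideal_def)
qed

lemma prime_ideal_dim_one:
  fixes M :: "'a::idom set"
  assumes "local_ring M" "krull_dim TYPE('a) = 1" "prime_ideal P" "P \<noteq> {0}"
  shows "P = M"
proof (rule ccontr)
  assume "P \<noteq> M"
  have "P \<subseteq> M" using assms(3) local_ring_contains[OF assms(1)] by (simp add: prime_ideal_def)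
  have M: "prime_ideal M" using maximal_ideal_prime local_ring_maximal assms(1) by blast
  have "{0::'a} \<noteq> UNIV" by (metis UNIV_I singletonD zero_neq_one)
  then have Z: "prime_ideal {0::'a}" by (simp add: prime_ideal_def)
  define Q where "Q n = (if n = 0 then {0} else if n = 1 then P else M)" for n :: nat
  have "0 \<in> P" using assms(3) idl.subspace_0 by (auto simp: prime_ideal_def)
  then have "(\<forall>i\<le>2. prime_ideal (Q i)) \<and> (\<forall>i<2. Q i \<subset> Q (Suc i))"
    using M Z assms(3,4) \<open>P \<subseteq> M\<close> \<open>P \<noteq> M\<close> by (auto simp: Q_def less_Suc_eq numeral_2_eq_2)
  then have "enat 2 \<le> krull_dim TYPE('a)" unfolding krull_dim_def by (intro Sup_upper) blast
  then show False using assms(2) by (simp add: one_enat_def)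
qed

text \<open>Noetherian induction: a maximal counterexample J is neither M nor the whole ring, hence
  not prime, so it contains some a b with a and b outside J. Both J + (a) and J + (b) contain a
  power of M, and their product lies in J.\<close>

lemma ideal_power_subset:
  fixes M :: "'a::idom set"
  assumes M: "local_ring M" "krull_dim TYPE('a) = 1" and A: "is_ideal A" "A \<noteq> {0}"
  shows "\<exists>N. ideal_power M N \<subseteq> A"
proof (rule ccontr)
  assume neg: "\<not> ?thesis"
  define \<A> where "\<A> = {J. is_ideal J \<and> J \<noteq> {0} \<and> (\<forall>N. \<not> ideal_power M N \<subseteq> J)}"
  have "\<exists>N\<in>\<A>. \<forall>J\<in>\<A>. N \<subseteq> J \<longrightarrow> J = N"
  proof (rule noetherian_maximal[OF local_ring_noetherian[OF M(1)]])
    show "\<A> \<noteq> {}" using A neg by (auto simp: \<A>_def)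
  qed (simp add: \<A>_def)
  then obtain J where J: "J \<in> \<A>" "\<And>K. K \<in> \<A> \<Longrightarrow> J \<subseteq> K \<Longrightarrow> K = J" by blast
  have I: "is_ideal J" "J \<noteq> {0}" and nJ: "\<And>N. \<not> ideal_power M N \<subseteq> J" using J(1) by (auto simp: \<A>_def)
  have "ideal_power M 1 = M"
    using M local_ring_maximal by (intro ideal_power_1) (auto simp: maximal_ideal_def)
  then have "J \<noteq> M" using nJ[of 1] by auto
  moreover have "J \<noteq> UNIV" using nJ[of 0] by auto
  ultimately have "\<not> prime_ideal J" using prime_ideal_dim_one[OF M] I by blast
  then obtain a b where ab: "a * b \<in> J" "a \<notin> J" "b \<notin> J"
    using I \<open>J \<noteq> UNIV\<close> by (auto simp: prime_ideal_def)
  have *: "\<exists>N. ideal_power M N \<subseteq> ideal_gen (insert z J)" if "z \<notin> J" for z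
  proof (rule ccontr)
    assume neg: "\<not> ?thesis"
    have sub: "J \<subseteq> ideal_gen (insert z J)" "z \<in> ideal_gen (insert z J)"
      by (auto intro: idl.span_base)
    have "ideal_gen (insert z J) \<in> \<A>"
      using neg sub I that idl.subspace_0[OF I(1)] unfolding \<A>_def by blast
    then show False using J(2) sub that by blast
  qed
  obtain m n where mn: "ideal_power M m \<subseteq> ideal_gen (insert a J)"
    "ideal_power M n \<subseteq> ideal_gen (insert b J)" using * ab by blast
  have "ideal_power M (m + n) \<subseteq> J"
  proof (rule ideal_power_add_subset[OF I(1)])
    fix x y assume xy: "x \<in> ideal_power M m" "y \<in> ideal_power M n"
    show "x * y \<in> J"
    proof (rule ideal_gen_mult[OF I(1)])
      show "x \<in> ideal_gen (insert a J)" "y \<in> ideal_gen (insert b J)" using mn xy by auto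
      show "u * v \<in> J" if "u \<in> insert a J" "v \<in> insert b J" for u v
        using that ab idl.subspace_scale[OF I(1)] by (metis insert_iff mult.commute)
    qed
  qed
  then show False using nJ by blast
qed

section \<open>Integral elements as fractions whose powers share a denominator\<close>

lemma to_fract_power [simp]: "to_fract (x ^ n) = to_fract x ^ n"
  by (induction n) auto

lemma fract_cases:
  fixes q :: "'a::idom fract"
  obtains a b where "b \<noteq> 0" "q = to_fract a / to_fract b"
  by (cases q) (simp add: Fract_conv_to_fract)

text \<open>With q = a/b and d the degree of an integral equation, s = b^d works: it clears the
  powers below d directly, and the monic equation reduces higher powers to lower ones.\<close>

lemma integral_imp_common_denominator:
  fixes q :: "'a::idom fract"
  assumes "q \<in> integral_closure"
  shows "\<exists>s. s \<noteq> 0 \<and> (\<forall>n. to_fract s * q ^ n \<in> range to_fract)"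
proof -
  obtain p :: "'a poly" where p: "lead_coeff p = 1" "poly (map_poly to_fract p) q = 0"
    using assms by (auto simp: integral_closure_def)
  define d where "d = degree p"
  have deg: "degree (map_poly to_fract p) = d"
    unfolding d_def by (rule degree_map_poly) auto
  obtain a b where ab: "b \<noteq> 0" "q = to_fract a / to_fract b" by (rule fract_cases)
  have "0 = (\<Sum>i\<le>d. to_fract (coeff p i) * q ^ i)"
    using p(2) by (simp add: poly_altdef deg coeff_map_poly)
  also have "\<dots> = (\<Sum>i<d. to_fract (coeff p i) * q ^ i) + q ^ d"
    using p(1) by (simp add: lessThan_Suc_atMost[symmetric] d_def)
  finally have qd: "q ^ d = (\<Sum>i<d. to_fract (- coeff p i) * q ^ i)"
    by (simp add: sum_negf eq_neg_iff_add_eq_0 add.commute)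
  have "to_fract (b ^ d) * q ^ n \<in> range to_fract" for n
  proof (induction n rule: less_induct)
    case (less n)
    show ?case
    proof (cases "n < d")
      case True
      then have "b ^ d = b ^ (d - n) * b ^ n" by (simp flip: power_add)
      then have "to_fract (b ^ d) * q ^ n = to_fract (b ^ (d - n) * a ^ n)"
        using ab by (simp add: power_divide)
      then show ?thesis by (metis rangeI)
    next
      case False
      then have "q ^ n = q ^ (n - d) * q ^ d" by (simp flip: power_add)
      then have eq: "to_fract (b ^ d) * q ^ n =
          (\<Sum>i<d. to_fract (- coeff p i) * (to_fract (b ^ d) * q ^ (n - d + i)))"
        by (simp only: qd) (simp add: sum_distrib_left power_add mult_ac)
      have "\<exists>r. to_fract (b ^ d) * q ^ (n - d + i) = to_fract r" if "i < d" for i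
      proof -
        have "n - d + i < n" using that False by linarith
        then show ?thesis using less.IH by blast
      qed
      then obtain r where r: "\<And>i. i < d \<Longrightarrow> to_fract (b ^ d) * q ^ (n - d + i) = to_fract (r i)" by metis
      have "to_fract (b ^ d) * q ^ n = to_fract (\<Sum>i<d. - coeff p i * r i)"
        unfolding eq to_fract_sum by (rule sum.cong) (auto simp: r simp del: to_fract_power)
      then show ?thesis by (metis rangeI)
    qed
  qed
  then show ?thesis using ab(1) by (intro exI[of _ "b ^ d"]) auto
qed

text \<open>All powers of q lie in the cyclic module s^(-1) R over a Noetherian ring. A relation
  expressing s q^N by lower terms, divided by s, is an integral equation.\<close>

lemma common_denominator_imp_integral:
  fixes q :: "'a::idom fract"
  assumes "noetherian TYPE('a)" "s \<noteq> 0" "\<And>n. to_fract s * q ^ n \<in> range to_fract"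
  shows "q \<in> integral_closure"
proof -
  have "\<forall>n. \<exists>r. to_fract s * q ^ n = to_fract r" using assms(3) by blast
  then obtain f where f: "\<And>n. to_fract s * q ^ n = to_fract (f n)" by (auto dest: choice)
  obtain N c where N: "f N = (\<Sum>i<N. c i * f i)" by (rule noetherian_sequence[OF assms(1)])
  have "to_fract s * q ^ N = (\<Sum>i<N. to_fract (c i) * (to_fract s * q ^ i))"
    unfolding f N to_fract_sum to_fract_mult ..
  also have "\<dots> = to_fract s * (\<Sum>i<N. to_fract (c i) * q ^ i)"
    by (simp only: sum_distrib_left mult.left_commute)
  finally have "to_fract s * q ^ N = to_fract s * (\<Sum>i<N. to_fract (c i) * q ^ i)" .
  then have eq: "q ^ N = (\<Sum>i<N. to_fract (c i) * q ^ i)" using assms(2) by simp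
  define p where "p = Poly (map (\<lambda>i. - c i) [0..<N] @ [1])"
  have co: "coeff p i = (if i < N then - c i else if i = N then 1 else 0)" for i
    by (auto simp: p_def nth_default_def nth_append)
  have deg: "degree p = N"
    by (rule antisym) (auto intro!: degree_le le_degree simp: co)
  have deg': "degree (map_poly to_fract p) = N"
    using deg by (subst degree_map_poly) auto
  have "poly (map_poly to_fract p) q = (\<Sum>i<N. to_fract (coeff p i) * q ^ i) + q ^ N"
    by (simp add: poly_altdef deg' coeff_map_poly lessThan_Suc_atMost[symmetric] co)
  also have "\<dots> = 0" unfolding eq by (simp add: co sum_negf)
  finally have "lead_coeff p = 1 \<and> poly (map_poly to_fract p) q = 0" using deg co by auto
  then show ?thesis unfolding integral_closure_def by blast
qed

section \<open>Derivatives of power series and torsion\<close>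

lemma mfps_coeff_simps [simp]:
  fixes f g :: "('n::finite, 'k::comm_ring_1) mfps"
  shows "mfps_coeff (0 :: ('n, 'k) mfps) e = 0"
    "mfps_coeff (f + g) e = mfps_coeff f e + mfps_coeff g e"
    "mfps_coeff (- f) e = - mfps_coeff f e"
    "mfps_coeff (f - g) e = mfps_coeff f e - mfps_coeff g e"
  by (simp_all add: zero_mfps_def plus_mfps_def uminus_mfps_def minus_mfps_def)

lemma mfps_coeff_mult:
  "mfps_coeff (f * g) e = (\<Sum>a\<in>{..e}. mfps_coeff f a * mfps_coeff g (e - a))"
  by (simp add: times_mfps_def)

lemma mfps_coeff_sum: "mfps_coeff (sum f A) e = (\<Sum>a\<in>A. mfps_coeff (f a) e)"
  by (induction A rule: infinite_finite_induct) auto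

abbreviation unit_exponent :: "'n \<Rightarrow> 'n \<Rightarrow> nat"
  where "unit_exponent i \<equiv> (\<lambda>j. if j = i then 1 else 0)"

abbreviation mfps_constant_coeff :: "('n, 'k) mfps \<Rightarrow> 'k"
  where "mfps_constant_coeff f \<equiv> mfps_coeff f (\<lambda>_. 0)"

abbreviation mfps_linear_coeff :: "'n \<Rightarrow> ('n, 'k) mfps \<Rightarrow> 'k"
  where "mfps_linear_coeff i f \<equiv> mfps_coeff f (unit_exponent i)"

lemma mfps_coeff_X_mult:
  fixes g :: "('n::finite, 'k::comm_ring_1) mfps"
  shows "mfps_coeff (mfps_X i * g) e = (if e i = 0 then 0 else mfps_coeff g (e(i := e i - 1)))"
proof -
  have "mfps_coeff (mfps_X i * g) e =
      (\<Sum>a\<in>{..e}. if a = unit_exponent i then mfps_coeff g (e - a) else 0)"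
    unfolding mfps_coeff_mult mfps_X_def mfps_coeff_Abs by (rule sum.cong) auto
  also have "\<dots> = (if unit_exponent i \<in> {..e} then mfps_coeff g (e - unit_exponent i) else 0)"
    by (rule sum.delta) simp
  also have "unit_exponent i \<in> {..e} \<longleftrightarrow> e i \<noteq> 0"
    by (auto simp: le_fun_def dest: spec[of _ i])
  also have "e - unit_exponent i = e(i := e i - 1)"
    by (auto simp: fun_eq_iff fun_diff_def)
  finally show ?thesis by simp
qed

lemma mfps_coeff_const_mult:
  fixes g :: "('n::finite, 'k::comm_ring_1) mfps"
  shows "mfps_coeff (mfps_const c * g) e = c * mfps_coeff g e"
proof -
  have "mfps_coeff (mfps_const c * g) e =
      (\<Sum>a\<in>{..e}. if a = (\<lambda>_. 0) then c * mfps_coeff g (e - a) else 0)"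
    unfolding mfps_coeff_mult mfps_const_def mfps_coeff_Abs by (rule sum.cong) auto
  also have "\<dots> = c * mfps_coeff g (e - (\<lambda>_. 0))"
    by (subst sum.delta) (auto simp: le_fun_def)
  also have "e - (\<lambda>_. 0) = e" by (simp add: fun_eq_iff fun_diff_def)
  finally show ?thesis .
qed

lemma mfps_constant_coeff_mult:
  fixes f g :: "('n::finite, 'k::comm_ring_1) mfps"
  shows "mfps_constant_coeff (f * g) = mfps_constant_coeff f * mfps_constant_coeff g"
proof -
  have "{..(\<lambda>_. 0) :: 'n \<Rightarrow> nat} = {\<lambda>_. 0}" by (auto simp: le_fun_def fun_eq_iff)
  then show ?thesis by (simp add: mfps_coeff_mult fun_diff_def)
qed

lemma mfps_linear_coeff_mult:
  fixes f g :: "('n::finite, 'k::comm_ring_1) mfps"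
  shows "mfps_linear_coeff i (f * g) =
    mfps_constant_coeff f * mfps_linear_coeff i g + mfps_linear_coeff i f * mfps_constant_coeff g"
proof -
  have key: "a = (\<lambda>_. 0) \<or> a = unit_exponent i" if "a \<le> unit_exponent i" for a :: "'n \<Rightarrow> nat"
  proof (cases "a i = 0")
    case True
    then have "a j = 0" for j using that by (cases "j = i") (auto simp: le_fun_def split: if_splits)
    then show ?thesis by auto
  next
    case False
    then have "a j = unit_exponent i j" for j
      using that[unfolded le_fun_def, rule_format, of j] by (cases "j = i") auto
    then show ?thesis by auto
  qed
  have "{..unit_exponent i :: 'n \<Rightarrow> nat} = {\<lambda>_. 0, unit_exponent i}"
  proof (intro equalityI subsetI)
    fix a :: "'n \<Rightarrow> nat" assume "a \<in> {..unit_exponent i}"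
    then show "a \<in> {\<lambda>_. 0, unit_exponent i}" using key[of a] by blast
  qed (auto simp: le_fun_def)
  moreover have "(\<lambda>_. 0) \<noteq> unit_exponent i" by (metis zero_neq_one)
  ultimately show ?thesis by (simp add: mfps_coeff_mult fun_diff_def)
qed

text \<open>\<open>ch\<close> assigns to each nonzero exponent vector one variable occurring in it,
  so every monomial is divided by exactly one variable and none is counted twice.\<close>

lemma mfps_decompose:
  fixes f :: "('n::finite, 'k::comm_ring_1) mfps"
  obtains g where "f = mfps_const (mfps_constant_coeff f) + (\<Sum>i\<in>UNIV. mfps_X i * g i)"
proof -
  define ch where "ch e = (SOME i. e i \<noteq> 0)" for e :: "'n \<Rightarrow> nat"
  define g :: "'n \<Rightarrow> ('n, 'k) mfps" where "g i = Abs_mfps (\<lambda>e.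
    let d = e(i := Suc (e i)) in if ch d = i then mfps_coeff f d else 0)" for i
  have "f = mfps_const (mfps_constant_coeff f) + (\<Sum>i\<in>UNIV. mfps_X i * g i)"
  proof (rule mfps_eqI)
    fix e
    have Xg: "mfps_coeff (mfps_X i * g i) e =
        (if e i \<noteq> 0 \<and> ch e = i then mfps_coeff f e else 0)" for i
      by (simp add: mfps_coeff_X_mult g_def Let_def)
    show "mfps_coeff f e =
      mfps_coeff (mfps_const (mfps_constant_coeff f) + (\<Sum>i\<in>UNIV. mfps_X i * g i)) e"
    proof (cases "e = (\<lambda>_. 0)")
      case True
      then show ?thesis by (simp add: mfps_coeff_sum mfps_coeff_X_mult mfps_const_def)
    next
      case False
      then have "e (ch e) \<noteq> 0" unfolding ch_def by (metis (mono_tags, lifting) someI_ex ext)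
      then have "(if e i \<noteq> 0 \<and> ch e = i then mfps_coeff f e else 0) =
          (if i = ch e then mfps_coeff f e else 0)" for i by auto
      then show ?thesis using False by (simp add: mfps_coeff_sum Xg mfps_const_def)
    qed
  qed
  then show ?thesis by (rule that)
qed

text \<open>The inverse is the geometric series of X_i / c, divided by c; \<open>S e\<close> says
  that no variable other than X_i occurs in the monomial e.\<close>

lemma mfps_const_minus_X_unit:
  fixes c :: "'k::field"
  assumes "c \<noteq> 0"
  shows "\<exists>h :: ('n::finite, 'k) mfps. (mfps_const c - mfps_X i) * h = 1"
proof -
  define S where "S e \<longleftrightarrow> (\<forall>j. j \<noteq> i \<longrightarrow> e j = 0)" for e :: "'n \<Rightarrow> nat"
  define h :: "('n, 'k) mfps" where
    "h = Abs_mfps (\<lambda>e. if S e then inverse c ^ Suc (e i) else 0)"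
  have "(mfps_const c - mfps_X i) * h = 1"
  proof (rule mfps_eqI)
    fix e :: "'n \<Rightarrow> nat"
    have co: "mfps_coeff ((mfps_const c - mfps_X i) * h) e =
        c * mfps_coeff h e - (if e i = 0 then 0 else mfps_coeff h (e(i := e i - 1)))"
      by (simp add: left_diff_distrib mfps_coeff_const_mult mfps_coeff_X_mult)
    show "mfps_coeff ((mfps_const c - mfps_X i) * h) e = mfps_coeff 1 e"
    proof (cases "e i")
      case 0
      then have "S e \<longleftrightarrow> e = (\<lambda>_. 0)" unfolding S_def by (metis ext)
      then show ?thesis using assms 0 unfolding co by (simp add: h_def one_mfps_def)
    next
      case (Suc m)
      then have "e \<noteq> (\<lambda>_. 0)" by auto
      have "S (e(i := m)) \<longleftrightarrow> S e" unfolding S_def by auto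
      then have "mfps_coeff h (e(i := m)) = c * mfps_coeff h e"
        unfolding h_def mfps_coeff_Abs using assms Suc by simp
      then show ?thesis using Suc \<open>e \<noteq> (\<lambda>_. 0)\<close> unfolding co by (simp add: one_mfps_def)
    qed
  qed
  then show ?thesis by blast
qed

lemma mfps_pderiv_diff:
  fixes f g :: "('n::finite, 'k::comm_ring_1) mfps"
  shows "mfps_pderiv i (f - g) = mfps_pderiv i f - mfps_pderiv i g"
  by (rule mfps_eqI) (simp add: mfps_pderiv_def right_diff_distrib)

lemma mfps_pderiv_sum:
  fixes f :: "'a \<Rightarrow> ('n::finite, 'k::comm_ring_1) mfps"
  shows "mfps_pderiv i (sum f A) = (\<Sum>a\<in>A. mfps_pderiv i (f a))"
  by (rule mfps_eqI) (simp add: mfps_pderiv_def mfps_coeff_sum sum_distrib_left)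

text \<open>Keeping the terms with \<open>a i = 0\<close>, whose factor vanishes, makes the sum
  range over the full index set of a product coefficient, so that the Leibniz rule can be compared
  termwise.\<close>

lemma mfps_coeff_pderiv_mult:
  fixes f g :: "('n::finite, 'k::comm_ring_1) mfps"
  shows "mfps_coeff (mfps_pderiv i f * g) e =
    (\<Sum>a\<in>{..e(i := Suc (e i))}.
      of_nat (a i) * mfps_coeff f a * mfps_coeff g (e(i := Suc (e i)) - a))"
proof -
  let ?e = "e(i := Suc (e i))"
  have "(\<Sum>a\<in>{..?e}. of_nat (a i) * mfps_coeff f a * mfps_coeff g (?e - a)) =
      (\<Sum>a\<in>{a\<in>{..?e}. a i \<noteq> 0}. of_nat (a i) * mfps_coeff f a * mfps_coeff g (?e - a))"
    by (rule sum.mono_neutral_right) auto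
  also have "\<dots> = (\<Sum>b\<in>{..e}. mfps_coeff (mfps_pderiv i f) b * mfps_coeff g (e - b))"
  proof (rule sum.reindex_bij_witness[where i = "\<lambda>b. b(i := Suc (b i))"
        and j = "\<lambda>a. a(i := a i - 1)"], goal_cases)
    case (1 a)
    then show ?case by simp
  next
    case (2 a)
    then have "a j \<le> ?e j" for j by (simp only: mem_Collect_eq atMost_iff le_fun_def)
    then have "(a(i := a i - 1)) j \<le> e j" for j
      by (cases "j = i") (use \<open>\<And>j. a j \<le> ?e j\<close>[of j] in auto)
    then show ?case by (simp only: atMost_iff le_fun_def simp_thms)
  next
    case (3 b)
    then show ?case by simp
  next
    case (4 b)
    then show ?case by (auto simp: le_fun_def)
  next
    case (5 a)
    then have "?e - a = e - a(i := a i - 1)" by (auto simp: fun_eq_iff fun_diff_def)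
    then show ?case using 5 by (simp add: mfps_pderiv_def)
  qed
  finally show ?thesis by (simp add: mfps_coeff_mult)
qed

text \<open>In every term of the Cauchy product the factor e_i + 1 splits as a_i + (e_i + 1 - a_i);
  reversing the second sum turns it into the derivative of g.\<close>

lemma mfps_pderiv_mult:
  fixes f g :: "('n::finite, 'k::comm_ring_1) mfps"
  shows "mfps_pderiv i (f * g) = mfps_pderiv i f * g + f * mfps_pderiv i g"
proof (rule mfps_eqI)
  fix e :: "'n \<Rightarrow> nat"
  let ?e = "e(i := Suc (e i))"
  have "mfps_coeff (mfps_pderiv i (f * g)) e =
      (\<Sum>a\<in>{..?e}. of_nat (?e i) * (mfps_coeff f a * mfps_coeff g (?e - a)))"
    by (simp add: mfps_pderiv_def mfps_coeff_mult sum_distrib_left)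
  also have "\<dots> = (\<Sum>a\<in>{..?e}. of_nat (a i) * mfps_coeff f a * mfps_coeff g (?e - a) +
      of_nat ((?e - a) i) * mfps_coeff g (?e - a) * mfps_coeff f a)"
  proof (rule sum.cong[OF refl])
    fix a assume "a \<in> {..?e}"
    then have "a i \<le> ?e i" by (simp only: atMost_iff le_fun_def)
    then have "?e i = a i + (?e - a) i" by (simp add: fun_diff_def)
    then have "(of_nat (?e i) :: 'k) = of_nat (a i) + of_nat ((?e - a) i)" by (metis of_nat_add)
    then show "of_nat (?e i) * (mfps_coeff f a * mfps_coeff g (?e - a)) =
      of_nat (a i) * mfps_coeff f a * mfps_coeff g (?e - a) +
      of_nat ((?e - a) i) * mfps_coeff g (?e - a) * mfps_coeff f a"
      by (simp only:) (simp add: algebra_simps)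
  qed
  also have "\<dots> = (\<Sum>a\<in>{..?e}. of_nat (a i) * mfps_coeff f a * mfps_coeff g (?e - a)) +
      (\<Sum>a\<in>{..?e}. of_nat ((?e - a) i) * mfps_coeff g (?e - a) * mfps_coeff f a)"
    by (rule sum.distrib)
  also have "(\<Sum>a\<in>{..?e}. of_nat ((?e - a) i) * mfps_coeff g (?e - a) * mfps_coeff f a) =
      (\<Sum>a\<in>{..?e}. of_nat (a i) * mfps_coeff g a * mfps_coeff f (?e - a))"
  proof (rule sum.reindex_bij_witness[where i = "\<lambda>a. ?e - a" and j = "\<lambda>a. ?e - a"])
    have inv: "?e - (?e - a) = a" if "a \<in> {..?e}" for a
    proof -
      have "a j \<le> ?e j" for j using that by (simp only: atMost_iff le_fun_def)
      then show ?thesis unfolding fun_eq_iff fun_diff_def by (metis diff_diff_cancel)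
    qed
    have mem: "?e - a \<in> {..?e}" for a by (simp add: le_fun_def fun_diff_def)
    fix a assume a: "a \<in> {..?e}"
    show "?e - (?e - a) = a" "?e - a \<in> {..?e}" "?e - (?e - a) = a" "?e - a \<in> {..?e}"
      using inv[OF a] mem[of a] by blast+
    show "of_nat ((?e - a) i) * mfps_coeff g (?e - a) * mfps_coeff f (?e - (?e - a)) =
      of_nat ((?e - a) i) * mfps_coeff g (?e - a) * mfps_coeff f a"
      by (simp only: inv[OF a])
  qed
  finally show "mfps_coeff (mfps_pderiv i (f * g)) e =
      mfps_coeff (mfps_pderiv i f * g + f * mfps_pderiv i g) e"
    by (simp only: mfps_coeff_simps mfps_coeff_pderiv_mult mult.commute[of f])
qed

lemma mfps_pderiv_power:
  fixes f :: "('n::finite, 'k::comm_ring_1) mfps"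
  shows "mfps_pderiv i (f ^ Suc n) = of_nat (Suc n) * f ^ n * mfps_pderiv i f"
  by (induction n) (simp_all add: mfps_pderiv_mult algebra_simps)

lemma mfps_constant_coeff_pderiv:
  fixes f :: "('n::finite, 'k::comm_ring_1) mfps"
  shows "mfps_constant_coeff (mfps_pderiv i f) = mfps_linear_coeff i f"
proof -
  have "(\<lambda>_. 0)(i := Suc 0) = unit_exponent i" by auto
  then show ?thesis by (simp add: mfps_pderiv_def)
qed

lemma mfps_linear_coeff_pderiv_commute:
  fixes f :: "('n::finite, 'k::comm_ring_1) mfps"
  shows "mfps_linear_coeff j (mfps_pderiv i f) = mfps_linear_coeff i (mfps_pderiv j f)"
proof (cases "i = j")
  case False
  then have "(unit_exponent j)(i := Suc 0) = (unit_exponent i)(j := Suc 0)" by auto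
  then show ?thesis using False by (simp add: mfps_pderiv_def)
qed simp

lemma mfps_maximal_ideal_square:
  fixes f :: "('n::finite, 'k::comm_ring_1) mfps"
  assumes "f \<in> ideal_power (ideal_gen (range mfps_X)) 2"
  shows "mfps_constant_coeff f = 0" "mfps_linear_coeff i f = 0"
proof -
  have X: "mfps_constant_coeff a = 0" if "a \<in> ideal_gen (range mfps_X)" for a :: "('n, 'k) mfps"
  proof -
    have "ideal_gen (range mfps_X) \<subseteq> {a :: ('n, 'k) mfps. mfps_constant_coeff a = 0}"
    proof (rule idl.span_minimal)
      show "range mfps_X \<subseteq> {a :: ('n, 'k) mfps. mfps_constant_coeff a = 0}"
        using mfps_coeff_X_mult[of _ "1 :: ('n, 'k) mfps" "\<lambda>_. 0"] by auto
      show "is_ideal {a :: ('n, 'k) mfps. mfps_constant_coeff a = 0}"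
        by (rule idl.subspaceI) (auto simp: mfps_constant_coeff_mult)
    qed
    then show ?thesis using that by blast
  qed
  have "ideal_power (ideal_gen (range mfps_X)) 2 \<subseteq>
    {f :: ('n, 'k) mfps. mfps_constant_coeff f = 0 \<and> mfps_linear_coeff i f = 0}"
    unfolding ideal_power_2[OF idl.subspace_span]
  proof (rule idl.span_minimal)
    show "{a * b |a b. a \<in> ideal_gen (range mfps_X) \<and> b \<in> ideal_gen (range mfps_X)} \<subseteq>
      {f :: ('n, 'k) mfps. mfps_constant_coeff f = 0 \<and> mfps_linear_coeff i f = 0}"
      by (auto simp: mfps_constant_coeff_mult mfps_linear_coeff_mult X)
    show "is_ideal {f :: ('n, 'k) mfps. mfps_constant_coeff f = 0 \<and> mfps_linear_coeff i f = 0}"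
      by (rule idl.subspaceI) (auto simp: mfps_constant_coeff_mult mfps_linear_coeff_mult)
  qed
  then show "mfps_constant_coeff f = 0" "mfps_linear_coeff i f = 0" using assms by auto
qed


section \<open>Presentations and the torsion differential\<close>

lemma ring_hom_simps:
  assumes "is_ring_hom h"
  shows "h 0 = 0" "h 1 = 1" "h (x + y) = h x + h y" "h (x * y) = h x * h y"
    "h (- x) = - h x" "h (x - y) = h x - h y" "h (x ^ n) = h x ^ n" "h (of_nat n) = of_nat n"
    "h (sum F A) = (\<Sum>a\<in>A. h (F a))"
proof -
  have one: "h 1 = 1" and add: "h (x + y) = h x + h y" and mult: "h (x * y) = h x * h y" for x y
    using assms by (auto simp: is_ring_hom_def)
  have zero: "h 0 = 0" using add[of 0 0] by simp
  have minus: "h (- x) = - h x" for x using add[of x "- x"] zero by (simp add: eq_neg_iff_add_eq_0 add.commute)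
  show "h 0 = 0" "h 1 = 1" "h (x + y) = h x + h y" "h (x * y) = h x * h y" "h (- x) = - h x"
    by (fact zero one add mult minus)+
  show "h (x - y) = h x - h y" using add[of x "- y"] minus by simp
  show "h (x ^ n) = h x ^ n" by (induction n) (simp_all add: one mult)
  show "h (of_nat n) = of_nat n" by (induction n) (simp_all add: zero one add)
  show "h (sum F A) = (\<Sum>a\<in>A. h (F a))"
    by (induction A rule: infinite_finite_induct) (simp_all add: zero add)
qed

lemma residue_scalar_zero:
  assumes "has_residue_field \<iota> M" "0 \<in> M" "\<iota> c \<in> M" "is_ideal M"
  shows "c = 0"
proof -
  have h: "is_ring_hom \<iota>" and u: "\<exists>!c. 0 - \<iota> c \<in> M"
    using assms(1) unfolding has_residue_field_def by blast+
  have "0 - \<iota> c \<in> M" "0 - \<iota> 0 \<in> M"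
    using assms(2,3) idl.subspace_neg[OF assms(4,3)] by (simp_all add: ring_hom_simps[OF h])
  with u show ?thesis by blast
qed

lemma ideal_gen_range_vec:
  fixes f :: "'a::comm_ring_1 ^ 'm::finite"
  assumes "x \<in> ideal_gen (range (($) f))"
  obtains g where "x = (\<Sum>j\<in>UNIV. g j * f $ j)"
proof -
  define T where "T g = (\<Sum>j\<in>UNIV. g j * f $ j)" for g
  let ?S = "range T"
  have "ideal_gen (range (($) f)) \<subseteq> ?S"
  proof (rule idl.span_minimal)
    show "range (($) f) \<subseteq> ?S"
    proof clarify
      fix i
      have "f $ i = T (\<lambda>j. if j = i then 1 else 0)"
        by (simp add: T_def if_distrib[of "\<lambda>x. x * _"] cong: if_cong)
      then show "f $ i \<in> ?S" by (simp only: rangeI)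
    qed
    show "is_ideal ?S"
    proof (rule idl.subspaceI)
      have "0 = T (\<lambda>_. 0)" by (simp add: T_def)
      then show "0 \<in> ?S" by (metis rangeI)
    next
      fix x y assume "x \<in> ?S" "y \<in> ?S"
      then obtain g h where "x = T g" "y = T h" by blast
      then have "x + y = T (\<lambda>j. g j + h j)"
        by (simp only: T_def distrib_right sum.distrib)
      then show "x + y \<in> ?S" by (simp only: rangeI)
    next
      fix c x assume "x \<in> ?S"
      then obtain g where "x = T g" by blast
      then have "c * x = T (\<lambda>j. c * g j)"
        by (simp only: T_def sum_distrib_left mult.assoc)
      then show "c * x \<in> ?S" by (simp only: rangeI)
    qed
  qed
  then obtain g where "x = T g" using assms by blast
  then show ?thesis using that by (simp add: T_def)
qed

text \<open>If the residue a of X_i were nonzero, a - X_i would be a unit of the power series ring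
  although its image lies in M. Locality of \<open>\<phi>\<close> thus follows from its
  compatibility with scalars.\<close>

lemma presentation_X_in_maximal:
  fixes \<iota> :: "'k::field \<Rightarrow> 'r::comm_ring_1" and \<phi> :: "('n::finite, 'k) mfps \<Rightarrow> 'r"
    and f :: "(('n, 'k) mfps) ^ 'm::finite"
  assumes P: "presentation \<iota> \<phi> f" and R: "has_residue_field \<iota> M" and M: "is_ideal M"
  shows "\<phi> (mfps_X i) \<in> M"
proof -
  have h: "is_ring_hom \<phi>" and c: "\<phi> (mfps_const a) = \<iota> a" for a
    using P by (auto simp: presentation_def)
  note hs = ring_hom_simps[OF h]
  have M0: "0 \<in> M" by (rule idl.subspace_0[OF M])
  have \<iota>: "is_ring_hom \<iota>" using R by (simp add: has_residue_field_def)
  obtain a where a: "\<phi> (mfps_X i) - \<iota> a \<in> M" using R unfolding has_residue_field_def by blast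
  have "a = 0"
  proof (rule ccontr)
    assume "a \<noteq> 0"
    then obtain g :: "('n, 'k) mfps" where "(mfps_const a - mfps_X i) * g = 1"
      using mfps_const_minus_X_unit by blast
    then have "(\<iota> a - \<phi> (mfps_X i)) * \<phi> g = 1" by (metis hs(2,4,6) c)
    moreover have "- \<phi> g * (\<phi> (mfps_X i) - \<iota> a) \<in> M" by (rule idl.subspace_scale[OF M a])
    ultimately have "1 \<in> M" by (simp add: algebra_simps)
    then have "\<iota> 1 \<in> M" by (simp add: ring_hom_simps[OF \<iota>])
    then show False using residue_scalar_zero[OF R M0 _ M] by force
  qed
  then show ?thesis using a by (simp add: ring_hom_simps[OF \<iota>])
qed

text \<open>
  In \<open>\<Omega>\<close> the relation \<open>x\<^sup>e = y\<^sup>v\<close> gives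
  \<open>x\<^sup>e (e y dx - v x dy) = x y d(x\<^sup>e - y\<^sup>v) = 0\<close>. If \<open>e y dx - v x dy\<close> were zero, then modulo the square
  of the maximal ideal it would be the differential of a quadratic form, and the symmetry of the
  Hessian of that form makes the linear parts of \<open>x\<close> and \<open>y\<close> proportional.
\<close>

lemma torsion_of_power_relation:
  fixes \<iota> :: "'k::field_char_0 \<Rightarrow> 'r::idom"
    and \<phi> :: "('n::finite, 'k) mfps \<Rightarrow> 'r"
    and f :: "(('n, 'k) mfps) ^ 'm::finite"
  assumes P: "presentation \<iota> \<phi> f" and R: "has_residue_field \<iota> M" and M: "is_ideal M"
    and sq: "ideal_gen (range (($) f)) \<subseteq> ideal_power (ideal_gen (range mfps_X)) 2"
    and xy: "x \<in> M" "y \<in> M" "x \<noteq> 0" "x ^ e = y ^ v" "e > 0" "v > 0"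
    and indep: "y \<notin> ideal_power M 2" "\<And>c. x - \<iota> c * y \<notin> ideal_power M 2"
  shows "coker_torsion (jacobian \<phi> f) \<noteq> {coker_zero (jacobian \<phi> f)}"
proof
  assume tors: "coker_torsion (jacobian \<phi> f) = {coker_zero (jacobian \<phi> f)}"
  have h: "is_ring_hom \<phi>" and const: "\<phi> (mfps_const a) = \<iota> a" and surj: "surj \<phi>"
    and ker: "\<phi> F = 0 \<longleftrightarrow> F \<in> ideal_gen (range (($) f))" for a F
    using P by (auto simp: presentation_def)
  note hs = ring_hom_simps[OF h]
  have \<iota>: "is_ring_hom \<iota>" using R by (simp add: has_residue_field_def)
  note Xm = presentation_X_in_maximal[OF P R M]
  have M0: "0 \<in> M" by (rule idl.subspace_0[OF M])
  have const0: "mfps_constant_coeff F = 0" if "\<phi> F \<in> M" for F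
  proof -
    obtain g where g: "F = mfps_const (mfps_constant_coeff F) + (\<Sum>i\<in>UNIV. mfps_X i * g i)"
      by (rule mfps_decompose)
    define S where "S = (\<Sum>i\<in>UNIV. \<phi> (g i) * \<phi> (mfps_X i))"
    have "\<phi> F = \<iota> (mfps_constant_coeff F) + S"
      unfolding S_def by (subst g) (simp only: hs const mult.commute)
    moreover have "S \<in> M" unfolding S_def
      by (intro idl.subspace_sum[OF M] idl.subspace_scale[OF M] Xm)
    ultimately have "\<iota> (mfps_constant_coeff F) \<in> M"
      using idl.subspace_diff[OF M that \<open>S \<in> M\<close>] by simp
    then show ?thesis by (rule residue_scalar_zero[OF R M0 _ M])
  qed
  have M_mem: "\<phi> F \<in> M" if F: "mfps_constant_coeff F = 0" for F
  proof -
    obtain g where g: "F = mfps_const (mfps_constant_coeff F) + (\<Sum>i\<in>UNIV. mfps_X i * g i)"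
      by (rule mfps_decompose)
    have "\<phi> F = \<iota> 0 + (\<Sum>i\<in>UNIV. \<phi> (g i) * \<phi> (mfps_X i))"
      by (subst g) (simp only: hs const mult.commute F)
    also have "\<dots> = (\<Sum>i\<in>UNIV. \<phi> (g i) * \<phi> (mfps_X i))" by (simp add: ring_hom_simps[OF \<iota>])
    also have "\<dots> \<in> M" by (intro idl.subspace_sum[OF M] idl.subspace_scale[OF M] Xm)
    finally show ?thesis .
  qed
  have M2_mem: "\<phi> F \<in> ideal_power M 2"
    if F: "mfps_constant_coeff F = 0" "\<And>i. mfps_linear_coeff i F = 0" for F
  proof -
    obtain g where g: "F = mfps_const (mfps_constant_coeff F) + (\<Sum>i\<in>UNIV. mfps_X i * g i)"
      by (rule mfps_decompose)
    \<comment> \<open>The coefficient of X_i in F is the constant coefficient of its cofactor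
      \<open>g i\<close>, so each cofactor maps into M.\<close>
    have g0: "mfps_constant_coeff (g i) = 0" for i
    proof -
      have Xg: "mfps_coeff (mfps_X j * g j) (unit_exponent i) =
          (if j = i then mfps_constant_coeff (g i) else 0)" for j
      proof -
        have "(unit_exponent i)(i := 0) = (\<lambda>_. 0)" by auto
        then show ?thesis by (simp add: mfps_coeff_X_mult)
      qed
      have "0 = mfps_linear_coeff i F" using F by simp
      also have "\<dots> = (\<Sum>j\<in>UNIV. mfps_coeff (mfps_X j * g j) (unit_exponent i))"
      proof -
        have "unit_exponent i \<noteq> (\<lambda>_. 0)" by (metis zero_neq_one)
        then show ?thesis by (subst g) (simp add: mfps_coeff_sum mfps_const_def)
      qed
      finally show ?thesis by (simp add: Xg)
    qed
    have mem: "\<phi> (mfps_X i) * \<phi> (g i) \<in> ideal_power M 2" for i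
      unfolding ideal_power_2[OF M] using Xm M_mem[OF g0] by (intro idl.span_base) blast
    have "\<phi> F = \<iota> 0 + (\<Sum>i\<in>UNIV. \<phi> (mfps_X i) * \<phi> (g i))"
      by (subst g) (simp only: hs const F)
    also have "\<dots> = (\<Sum>i\<in>UNIV. \<phi> (mfps_X i) * \<phi> (g i))" by (simp add: ring_hom_simps[OF \<iota>])
    also have "\<dots> \<in> ideal_power M 2" by (intro idl.subspace_sum is_ideal_power mem)
    finally show ?thesis .
  qed
  obtain X Y where X: "\<phi> X = x" and Y: "\<phi> Y = y" using surj by (metis surjD)
  have X0: "mfps_constant_coeff X = 0" and Y0: "mfps_constant_coeff Y = 0"
    using const0 X Y xy by auto
  \<comment> \<open>The coefficient of dX_i in a lift of the form e y dx - v x dy to the power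
    series ring.\<close>
  define A where "A i = of_nat e * Y * mfps_pderiv i X - of_nat v * X * mfps_pderiv i Y" for i
  define J where "J = jacobian \<phi> f"
  define \<omega> :: "'r ^ 'n" where "\<omega> = (\<chi> i. \<phi> (A i))"
  have J_nth: "(J *v g) $ i = (\<Sum>j\<in>UNIV. \<phi> (mfps_pderiv i (f $ j)) * g $ j)" for g i
    by (simp add: J_def jacobian_def matrix_vector_mult_def)

  have "\<phi> (X ^ e - Y ^ v) = 0" using xy by (simp add: hs X Y)
  then obtain g where g: "X ^ e - Y ^ v = (\<Sum>j\<in>UNIV. g j * f $ j)"
    using ker ideal_gen_range_vec by blast
  have "x ^ e *s \<omega> = J *v (\<chi> j. x * y * \<phi> (g j))"
  proof (rule vec_eq_iff[THEN iffD2], rule allI)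
    fix i
    obtain e' v' where ev: "e = Suc e'" "v = Suc v'" using xy by (metis gr0_conv_Suc)
    have f0: "\<phi> (f $ j) = 0" for j using ker by (auto intro: idl.span_base)
    \<comment> \<open>In the derivative of the sum of the g_j f_j, the terms in which g_j is
      differentiated vanish in R, because f_j maps to zero.\<close>
    have "of_nat e * x ^ e' * \<phi> (mfps_pderiv i X) - of_nat v * y ^ v' * \<phi> (mfps_pderiv i Y) =
        \<phi> (mfps_pderiv i (X ^ e - Y ^ v))"
      unfolding ev mfps_pderiv_diff mfps_pderiv_power by (simp only: hs X Y)
    also have "\<dots> = (\<Sum>j\<in>UNIV. \<phi> (mfps_pderiv i (f $ j)) * \<phi> (g j))"
      unfolding g mfps_pderiv_sum mfps_pderiv_mult hs f0 by (simp add: mult.commute)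
    finally have D: "of_nat e * x ^ e' * \<phi> (mfps_pderiv i X) -
        of_nat v * y ^ v' * \<phi> (mfps_pderiv i Y) =
        (\<Sum>j\<in>UNIV. \<phi> (mfps_pderiv i (f $ j)) * \<phi> (g j))" .
    have "(x ^ e *s \<omega>) $ i = of_nat e * y * x ^ e * \<phi> (mfps_pderiv i X) -
        of_nat v * x * x ^ e * \<phi> (mfps_pderiv i Y)"
      by (simp add: \<omega>_def A_def hs X Y algebra_simps)
    also have "\<dots> = of_nat e * y * x ^ e * \<phi> (mfps_pderiv i X) -
        of_nat v * x * y ^ v * \<phi> (mfps_pderiv i Y)"
      using xy(4) by simp
    also have "\<dots> = x * y * (of_nat e * x ^ e' * \<phi> (mfps_pderiv i X) -
        of_nat v * y ^ v' * \<phi> (mfps_pderiv i Y))"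
      unfolding ev power_Suc right_diff_distrib by (simp only: mult_ac)
    also have "\<dots> = (J *v (\<chi> j. x * y * \<phi> (g j))) $ i"
      unfolding D J_nth by (simp add: sum_distrib_left mult_ac)
    finally show "(x ^ e *s \<omega>) $ i = (J *v (\<chi> j. x * y * \<phi> (g j))) $ i" .
  qed
  then obtain b where b: "x ^ e *s \<omega> = J *v b" by blast
  have "(x ^ e *s \<omega>) +o range ((*v) J) = range ((*v) J)"
  proof -
    have "J *v b + J *v c = J *v (b + c)" "J *v c = J *v b + J *v (c - b)" for c
      by (simp_all flip: matrix_vector_right_distrib)
    then show ?thesis unfolding b elt_set_plus_def by blast
  qed
  then have "coker_scale J (x ^ e) (\<omega> +o range ((*v) J)) = coker_zero J"
    unfolding coker_scale_coset coker_zero_def .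
  moreover have "x ^ e \<noteq> 0" using xy(3) by simp
  ultimately have "\<omega> +o range ((*v) J) \<in> coker_torsion J"
    unfolding coker_torsion_def cokernel_def by blast
  then have "\<omega> +o range ((*v) J) = range ((*v) J)"
    using tors by (simp add: J_def coker_zero_def)
  moreover have "\<omega> + J *v 0 \<in> \<omega> +o range ((*v) J)" by (intro set_plus_intro2 rangeI)
  ultimately have "\<omega> \<in> range ((*v) J)" by simp
  then obtain r where r: "\<omega> = J *v r" by blast
  have G: "\<phi> (inv \<phi> (r $ j)) = r $ j" for j by (rule surj_f_inv_f[OF surj])
  define G where "G j = inv \<phi> (r $ j)" for j
  note G = G[folded G_def]

  have fsq: "mfps_constant_coeff F = 0" "mfps_linear_coeff i F = 0"
    if "F \<in> ideal_gen (range (($) f))" for F i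
    using mfps_maximal_ideal_square sq that by blast+
  have fj: "mfps_linear_coeff i (f $ j) = 0" for i j
    by (rule fsq) (rule idl.span_base, simp)
  \<comment> \<open>The f_j start in degree two, so their derivatives have no constant term and only
    the constant terms of the G_j matter; the ambiguity modulo the kernel has no linear part
    either.\<close>
  have lin: "mfps_linear_coeff l (A i) =
      (\<Sum>j\<in>UNIV. mfps_linear_coeff l (mfps_pderiv i (f $ j)) * mfps_constant_coeff (G j))" for i l
  proof -
    have "\<phi> (A i) = \<omega> $ i" by (simp add: \<omega>_def)
    also have "\<dots> = \<phi> (\<Sum>j\<in>UNIV. mfps_pderiv i (f $ j) * G j)"
      by (simp only: r J_nth hs G)
    finally have "\<phi> (A i - (\<Sum>j\<in>UNIV. mfps_pderiv i (f $ j) * G j)) = 0" by (simp only: hs diff_self)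
    then have "mfps_linear_coeff l (A i - (\<Sum>j\<in>UNIV. mfps_pderiv i (f $ j) * G j)) = 0"
      using ker fsq(2) by blast
    then have "mfps_linear_coeff l (A i) =
        (\<Sum>j\<in>UNIV. mfps_linear_coeff l (mfps_pderiv i (f $ j) * G j))"
      by (simp add: mfps_coeff_sum)
    then show ?thesis
      by (simp only: mfps_linear_coeff_mult mfps_constant_coeff_pderiv fj mult_zero_left add_0)
  qed
  have linA: "mfps_linear_coeff l (A i) =
      of_nat e * (mfps_linear_coeff l Y * mfps_linear_coeff i X) -
      of_nat v * (mfps_linear_coeff l X * mfps_linear_coeff i Y)" for i l
  proof -
    have of_nat: "of_nat n = mfps_const (of_nat n :: 'k)" for n
      by (induction n) (auto intro!: mfps_eqI simp: mfps_const_def one_mfps_def)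
    show ?thesis
      unfolding A_def of_nat
      by (simp only: mult.assoc mfps_coeff_simps mfps_coeff_const_mult)
        (simp add: mfps_linear_coeff_mult mfps_constant_coeff_pderiv X0 Y0)
  qed
  \<comment> \<open>The linear coefficients of the A_i form a combination of Hessians, hence a
    symmetric matrix. Its difference with the transpose is e + v times the 2 x 2 minors of the
    linear parts of X and Y, and e + v is nonzero in characteristic zero.\<close>
  have sym: "mfps_linear_coeff l X * mfps_linear_coeff i Y =
      mfps_linear_coeff i X * mfps_linear_coeff l Y" for i l
  proof -
    have "mfps_linear_coeff l (A i) = mfps_linear_coeff i (A l)"
      unfolding lin by (simp only: mfps_linear_coeff_pderiv_commute[where i = i and j = l])
    then have "of_nat (e + v) * (mfps_linear_coeff l X * mfps_linear_coeff i Y -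
        mfps_linear_coeff i X * mfps_linear_coeff l Y) = 0"
      unfolding linA by (simp add: algebra_simps)
    moreover have "of_nat (e + v) \<noteq> (0 :: 'k)" using xy(5) of_nat_eq_0_iff[of "e + v", where 'a = 'k] by simp
    ultimately show ?thesis by simp
  qed
  \<comment> \<open>Since y is outside M^2, Y has a nonzero linear coefficient; the vanishing minors
    make c the common ratio of the linear parts.\<close>
  obtain i where i: "mfps_linear_coeff i Y \<noteq> 0" using M2_mem[of Y] Y0 Y indep(1) by auto
  define c where "c = mfps_linear_coeff i X / mfps_linear_coeff i Y"
  have "\<phi> (X - mfps_const c * Y) \<in> ideal_power M 2"
  proof (rule M2_mem)
    show "mfps_constant_coeff (X - mfps_const c * Y) = 0"
      by (simp add: mfps_coeff_const_mult X0 Y0)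
    show "mfps_linear_coeff l (X - mfps_const c * Y) = 0" for l
    proof -
      have "c * mfps_linear_coeff l Y = mfps_linear_coeff l X"
        using i sym[of l i] by (simp add: c_def field_simps)
      then show ?thesis by (simp add: mfps_coeff_const_mult)
    qed
  qed
  then show False using indep(2) by (simp add: hs const X Y)
qed

section \<open>Completeness of the integral closure\<close>

lemma range_to_fract_closed:
  fixes a b :: "'a::idom fract"
  assumes "a \<in> range to_fract" "b \<in> range to_fract"
  shows "a + b \<in> range to_fract" "a * b \<in> range to_fract"
  using assms by (auto simp flip: to_fract_add to_fract_mult)

lemma range_to_fract_sum:
  "(\<And>i. i \<in> A \<Longrightarrow> F i \<in> range to_fract) \<Longrightarrow> sum F A \<in> range (to_fract :: 'a::idom \<Rightarrow> _)"
proof (induction A rule: infinite_finite_induct)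
  case (insert x A)
  then show ?case by (simp add: range_to_fract_closed)
qed (auto intro: range_eqI[of _ _ 0])

lemma to_fract_of_nat [simp]: "to_fract (of_nat n) = of_nat n"
  by (induction n) auto

lemma integral_closure_base: "to_fract r \<in> integral_closure"
proof -
  have "poly (map_poly to_fract [:- r, 1:]) (to_fract r) = 0"
    by (simp add: map_poly_pCons)
  moreover have "lead_coeff [:- r, 1:] = 1" by simp
  ultimately show ?thesis unfolding integral_closure_def by blast
qed

lemma integral_closure_mult:
  fixes a b :: "'a::idom fract"
  assumes N: "noetherian TYPE('a)" and a: "a \<in> integral_closure" and b: "b \<in> integral_closure"
  shows "a * b \<in> integral_closure"
proof -
  obtain s where s: "s \<noteq> 0" "\<And>n. to_fract s * a ^ n \<in> range to_fract"
    using integral_imp_common_denominator[OF a] by auto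
  obtain t where t: "t \<noteq> 0" "\<And>n. to_fract t * b ^ n \<in> range to_fract"
    using integral_imp_common_denominator[OF b] by auto
  note st = s t
  have "to_fract (s * t) * (a * b) ^ n = (to_fract s * a ^ n) * (to_fract t * b ^ n)" for n
    by (simp add: power_mult_distrib mult_ac)
  then show ?thesis using st
    by (intro common_denominator_imp_integral[OF N, of "s * t"])
      (simp_all add: range_to_fract_closed del: to_fract_mult)
qed

text \<open>After multiplication by s t, each term of the binomial expansion splits into a power of
  a cleared by s and a power of b cleared by t.\<close>

lemma integral_closure_add:
  fixes a b :: "'a::idom fract"
  assumes N: "noetherian TYPE('a)" and a: "a \<in> integral_closure" and b: "b \<in> integral_closure"
  shows "a + b \<in> integral_closure"
proof -
  obtain s where s: "s \<noteq> 0" "\<And>n. to_fract s * a ^ n \<in> range to_fract"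
    using integral_imp_common_denominator[OF a] by auto
  obtain t where t: "t \<noteq> 0" "\<And>n. to_fract t * b ^ n \<in> range to_fract"
    using integral_imp_common_denominator[OF b] by auto
  note st = s t
  have "to_fract (s * t) * (a + b) ^ n \<in> range to_fract" for n
  proof -
    have "to_fract (s * t) * (a + b) ^ n =
        (\<Sum>i\<le>n. to_fract (of_nat (n choose i)) * ((to_fract s * a ^ i) * (to_fract t * b ^ (n - i))))"
      by (simp add: binomial_ring sum_distrib_left mult_ac)
    also have "\<dots> \<in> range to_fract"
      by (intro range_to_fract_sum range_to_fract_closed st rangeI)
    finally show ?thesis .
  qed
  then show ?thesis using st
    by (intro common_denominator_imp_integral[OF N, of "s * t"]) simp_all
qed

text \<open>The second assumption on \<open>x0\<close> says that it multiplies the integral closure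
  into R. The element \<open>y0\<close> is arbitrary; its powers define the topology in which limits
  in the integral closure are taken.\<close>

locale analytic_branch =
  fixes \<iota> :: "'k::{alg_closed_field, field_char_0} \<Rightarrow> 'r::idom"
    and M :: "'r set" and x0 y0 :: 'r
  assumes local: "local_ring M"
    and complete: "adically_complete M"
    and dim: "krull_dim TYPE('r) = 1"
    and residue: "has_residue_field \<iota> M"
    and x0: "x0 \<noteq> 0" "\<And>q. q \<in> integral_closure \<Longrightarrow> to_fract x0 * q \<in> range to_fract"
    and y0: "y0 \<in> M" "y0 \<noteq> 0"
begin

abbreviation B :: "'r fract set" where "B \<equiv> integral_closure"
abbreviation X :: "'r fract" where "X \<equiv> to_fract x0"
abbreviation Y :: "'r fract" where "Y \<equiv> to_fract y0"

definition \<kappa> :: "'k \<Rightarrow> 'r fract" where "\<kappa> c = to_fract (\<iota> c)"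

text \<open>Divisibility with quotient in B, for arguments in the whole fraction field; thus
  \<open>divs 1 a\<close> means that a lies in B.\<close>

definition divs :: "'r fract \<Rightarrow> 'r fract \<Rightarrow> bool"
  where "divs d a \<longleftrightarrow> (\<exists>b\<in>B. a = d * b)"

text \<open>This will turn out to be the maximal ideal of the integral closure.\<close>

definition nil :: "'r fract set"
  where "nil = {a \<in> B. \<exists>N. divs Y (a ^ N)}"

definition unitB :: "'r fract \<Rightarrow> bool"
  where "unitB a \<longleftrightarrow> a \<noteq> 0 \<and> a \<in> B \<and> inverse a \<in> B"

lemma noeth: "noetherian TYPE('r)"
  by (rule local_ring_noetherian[OF local])

lemma M_ideal: "is_ideal M"
  using local_ring_maximal[OF local] by (simp add: maximal_ideal_def)

lemma \<iota>_hom: "is_ring_hom \<iota>"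
  using residue by (simp add: has_residue_field_def)

lemmas \<iota>_simps = ring_hom_simps[OF \<iota>_hom]

lemma \<iota>_in_M: "\<iota> c \<in> M \<Longrightarrow> c = 0"
  by (rule residue_scalar_zero[OF residue idl.subspace_0[OF M_ideal] _ M_ideal])

lemma \<kappa>_simps: "\<kappa> 0 = 0" "\<kappa> 1 = 1" "\<kappa> (a + b) = \<kappa> a + \<kappa> b" "\<kappa> (a * b) = \<kappa> a * \<kappa> b"
  "\<kappa> (- a) = - \<kappa> a" "\<kappa> (a - b) = \<kappa> a - \<kappa> b" "\<kappa> (a ^ n) = \<kappa> a ^ n" "\<kappa> (of_nat n) = of_nat n"
  by (simp_all add: \<kappa>_def \<iota>_simps)

lemma B_base: "to_fract r \<in> B" and B_mult: "a \<in> B \<Longrightarrow> b \<in> B \<Longrightarrow> a * b \<in> B"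
  and B_add: "a \<in> B \<Longrightarrow> b \<in> B \<Longrightarrow> a + b \<in> B"
  by (fact integral_closure_base integral_closure_mult[OF noeth] integral_closure_add[OF noeth])+

lemma B_0: "0 \<in> B" and B_1: "1 \<in> B"
  using B_base[of 0] B_base[of 1] by simp_all

lemma B_uminus: "a \<in> B \<Longrightarrow> - a \<in> B"
  using B_mult[OF B_base[of "- 1"]] by simp

lemma B_diff: "a \<in> B \<Longrightarrow> b \<in> B \<Longrightarrow> a - b \<in> B"
  using B_add[OF _ B_uminus] by force

lemma B_power: "a \<in> B \<Longrightarrow> a ^ n \<in> B"
  by (induction n) (simp_all add: B_1 B_mult)

lemma B_of_nat: "of_nat n \<in> B"
  using B_base[of "of_nat n"] by simp

lemma B_\<kappa>: "\<kappa> c \<in> B"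
  by (simp add: \<kappa>_def B_base)

lemmas B_closed = B_0 B_1 B_base B_mult B_add B_uminus B_diff B_power B_of_nat B_\<kappa>

section \<open>Divisibility and the Y-adic topology of the integral closure\<close>

lemma divs_0: "divs d 0"
  using B_0 by (auto simp: divs_def)

lemma divs_1: "a \<in> B \<Longrightarrow> divs 1 a"
  by (auto simp: divs_def)

lemma divs_add: "divs d a \<Longrightarrow> divs d b \<Longrightarrow> divs d (a + b)"
  unfolding divs_def by (metis B_add distrib_left)

lemma divs_uminus: "divs d a \<Longrightarrow> divs d (- a)"
  unfolding divs_def by (metis B_uminus mult_minus_right)

lemma divs_diff: "divs d a \<Longrightarrow> divs d b \<Longrightarrow> divs d (a - b)"
  using divs_add[OF _ divs_uminus] by force

lemma divs_mult: "divs d a \<Longrightarrow> c \<in> B \<Longrightarrow> divs d (c * a)"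
  unfolding divs_def by (metis B_mult mult.left_commute)

lemma divs_mult2: "divs d a \<Longrightarrow> divs e b \<Longrightarrow> divs (d * e) (a * b)"
  unfolding divs_def by (metis B_mult mult.assoc mult.left_commute)

lemma divs_power: "divs d a \<Longrightarrow> divs (d ^ n) (a ^ n)"
  unfolding divs_def by (metis B_power power_mult_distrib)

lemma divs_trans: "divs d e \<Longrightarrow> divs e a \<Longrightarrow> divs d a"
  unfolding divs_def by (metis B_mult mult.assoc)

lemma divs_power_le: "d \<in> B \<Longrightarrow> m \<le> n \<Longrightarrow> divs (d ^ m) (d ^ n)"
  unfolding divs_def by (metis B_power le_add_diff_inverse power_add)

lemma divs_sum: "(\<And>i. i \<in> A \<Longrightarrow> divs d (F i)) \<Longrightarrow> divs d (sum F A)"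
  by (induction A rule: infinite_finite_induct) (simp_all add: divs_0 divs_add)

text \<open>Multiplication by \<open>x0\<close> carries Y^i B into the i-th power of M; this is how
  separatedness and completeness of R reach B.\<close>

lemma divs_Y_power_in_ideal_power:
  assumes "divs (Y ^ i) a"
  shows "\<exists>r\<in>ideal_power M i. X * a = to_fract r"
proof -
  obtain b where b: "b \<in> B" "a = Y ^ i * b" using assms by (auto simp: divs_def)
  obtain r where r: "X * b = to_fract r" using x0(2)[OF b(1)] by blast
  have "X * a = to_fract (y0 ^ i) * (X * b)" by (simp add: b)
  also have "\<dots> = to_fract (r * y0 ^ i)" unfolding r by (simp add: mult.commute)
  finally show ?thesis
    using idl.subspace_scale[OF is_ideal_power power_in_ideal_power[OF y0(1)]] by blast
qed

lemma divs_Y_power_imp_zero: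
  assumes "\<And>i. divs (Y ^ i) a"
  shows "a = 0"
proof -
  obtain r where r: "X * a = to_fract r" using divs_Y_power_in_ideal_power[OF assms[of 0]] by blast
  have "r \<in> ideal_power M i" for i
    using divs_Y_power_in_ideal_power[OF assms[of i]] r by auto
  then have "r \<in> (\<Inter>i. ideal_power M i)" by blast
  then have "r = 0" using complete by (auto simp: adically_complete_def)
  then show ?thesis using r x0(1) by simp
qed

text \<open>In dimension one a nonzero principal ideal contains a power of M. This is the converse
  comparison between the M-adic and Y-adic topologies.\<close>

lemma M_power_subset: "r \<noteq> 0 \<Longrightarrow> \<exists>N. \<forall>s\<in>ideal_power M N. \<exists>z. s = z * r"
proof -
  assume "r \<noteq> 0"
  have "\<exists>N. ideal_power M N \<subseteq> ideal_gen {r}"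
    using idl.span_base[of r "{r}"] \<open>r \<noteq> 0\<close> by (intro ideal_power_subset[OF local dim]) auto
  then show ?thesis by (auto simp: idl.span_singleton)
qed

lemma telescope:
  assumes "\<And>i. divs (d ^ i) (s (Suc i) - s i)" "d \<in> B" "i \<le> j"
  shows "divs (d ^ i) (s j - s i)"
  using assms(3)
proof (induction j rule: dec_induct)
  case base
  then show ?case by (simp add: divs_0)
next
  case (step j)
  have "divs (d ^ i) (s (Suc j) - s j)"
    using divs_trans[OF divs_power_le[OF assms(2)] assms(1)] step by simp
  from divs_add[OF this step.IH] show ?case by simp
qed

text \<open>The sequence X s_i is Cauchy in R, and its limit divided by X is the limit in B.
  Dividing by X costs precision: only at a large index j does the error lie in x0 y0^i R, and
  telescoping returns from j to i.\<close>

lemma B_complete: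
  assumes s: "\<And>i. s i \<in> B" "\<And>i. divs (Y ^ i) (s (Suc i) - s i)"
  shows "\<exists>l\<in>B. \<forall>i. divs (Y ^ i) (l - s i)"
proof -
  have "\<forall>i. \<exists>r. X * s i = to_fract r" using x0(2)[OF s(1)] by blast
  then obtain r where r: "\<And>i. X * s i = to_fract (r i)" by metis
  have "r (Suc i) - r i \<in> ideal_power M i" for i
  proof -
    obtain z where z: "z \<in> ideal_power M i" "X * (s (Suc i) - s i) = to_fract z"
      using divs_Y_power_in_ideal_power[OF s(2)] by blast
    have "to_fract (r (Suc i) - r i) = to_fract z"
      unfolding z(2)[symmetric] by (simp add: right_diff_distrib r)
    then show ?thesis using z(1) by (simp only: to_fract_eq_iff)
  qed
  then obtain l' where l': "\<And>i. l' - r i \<in> ideal_power M i"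
    using complete unfolding adically_complete_def by blast
  define l where "l = to_fract l' / X"
  have key: "\<exists>j\<ge>i. divs (Y ^ i) (l - s j)" for i
  proof -
    have "x0 * y0 ^ i \<noteq> 0" using x0 y0 by simp
    then obtain N where N: "\<And>s. s \<in> ideal_power M N \<Longrightarrow> \<exists>z. s = z * (x0 * y0 ^ i)"
      using M_power_subset by blast
    define j where "j = max i N"
    have "l' - r j \<in> ideal_power M N"
      using l'[of j] ideal_power_antimono[of N j M] by (auto simp: j_def)
    then obtain z where z: "l' - r j = z * (x0 * y0 ^ i)" using N by blast
    have "X * (l - s j) = to_fract (l' - r j)"
      using x0(1) by (simp add: right_diff_distrib r l_def)
    also have "\<dots> = X * (Y ^ i * to_fract z)" unfolding z by (simp add: mult_ac)
    finally have "l - s j = Y ^ i * to_fract z" using x0(1) by simp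
    then show ?thesis unfolding divs_def j_def by (intro exI[of _ "max i N"]) (auto simp: B_base)
  qed
  have "divs (Y ^ i) (l - s i)" for i
  proof -
    obtain j where j: "j \<ge> i" "divs (Y ^ i) (l - s j)" using key by blast
    have "divs (Y ^ i) (s j - s i)" by (rule telescope[OF s(2) B_base j(1)])
    from divs_add[OF j(2) this] show ?thesis by simp
  qed
  moreover have "l \<in> B"
  proof -
    have "divs 1 (l - s 0)" using \<open>divs (Y ^ 0) (l - s 0)\<close> by simp
    then have "l - s 0 \<in> B" by (auto simp: divs_def)
    from B_add[OF this s(1)[of 0]] show ?thesis by simp
  qed
  ultimately show ?thesis by blast
qed

section \<open>Elements with a power divisible by Y, and units\<close>

lemma nil_B: "a \<in> nil \<Longrightarrow> a \<in> B"
  by (simp add: nil_def)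

lemma nil_divs: "a \<in> B \<Longrightarrow> divs Y a \<Longrightarrow> a \<in> nil"
  unfolding nil_def by (auto intro!: exI[of _ 1])

lemma Y_nil: "Y \<in> nil"
  by (rule nil_divs[OF B_base]) (auto simp: divs_def intro: bexI[OF _ B_1])

lemma nil_mult: "a \<in> nil \<Longrightarrow> c \<in> B \<Longrightarrow> c * a \<in> nil"
  unfolding nil_def by (auto simp: B_mult power_mult_distrib intro: divs_mult B_power)

lemma nil_power_imp: "a \<in> B \<Longrightarrow> a ^ n \<in> nil \<Longrightarrow> a \<in> nil"
  unfolding nil_def by (auto simp flip: power_mult)

lemma nil_uminus: "a \<in> nil \<Longrightarrow> - a \<in> nil"
  using nil_mult[OF _ B_uminus[OF B_1]] by simp

lemma nil_add:
  assumes "a \<in> nil" "b \<in> nil"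
  shows "a + b \<in> nil"
proof -
  obtain m n where mn: "divs Y (a ^ m)" "divs Y (b ^ n)" and B: "a \<in> B" "b \<in> B"
    using assms by (auto simp: nil_def)
  have "divs Y ((a + b) ^ (m + n))"
    unfolding binomial_ring
  proof (rule divs_sum)
    fix i assume "i \<in> {..m + n}"
    show "divs Y (of_nat (m + n choose i) * a ^ i * b ^ (m + n - i))"
    proof (cases "m \<le> i")
      case True
      then have "divs Y (a ^ i)" using divs_trans[OF _ divs_power_le] mn(1) B
        by (metis B_power divs_mult le_add_diff_inverse2 power_add)
      then have "divs Y ((of_nat (m + n choose i) * b ^ (m + n - i)) * a ^ i)"
        by (intro divs_mult B_closed B)
      then show ?thesis by (simp add: mult_ac)
    next
      case False
      then have "n \<le> m + n - i" by simp
      then have "divs Y (b ^ (m + n - i))"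
        using mn(2) B by (metis B_power divs_mult le_add_diff_inverse2 power_add)
      then show ?thesis by (intro divs_mult B_closed B)
    qed
  qed
  then show ?thesis using B B_add by (auto simp: nil_def)
qed

lemma nil_diff: "a \<in> nil \<Longrightarrow> b \<in> nil \<Longrightarrow> a - b \<in> nil"
  using nil_add[OF _ nil_uminus] by force

lemma nil_0: "0 \<in> nil"
  using nil_diff[OF Y_nil Y_nil] by simp

text \<open>If Y divided 1, so would all its powers, against separatedness.\<close>

lemma one_not_nil: "1 \<notin> nil"
proof
  assume "1 \<in> nil"
  then have "divs Y 1" by (simp add: nil_def)
  then have "divs (Y ^ i) 1" for i using divs_power[of Y 1 i] by simp
  then show False using divs_Y_power_imp_zero[of 1] by simp
qed

lemma nil_not_unit: "unitB a \<Longrightarrow> a \<notin> nil"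
  using nil_mult[of a "inverse a"] one_not_nil by (auto simp: unitB_def)

lemma M_nil: "r \<in> M \<Longrightarrow> to_fract r \<in> nil"
proof -
  assume r: "r \<in> M"
  obtain N z where "r ^ N = z * y0"
    using M_power_subset[OF y0(2)] power_in_ideal_power[OF r] by blast
  then have "to_fract r ^ N = Y * to_fract z" by (metis mult.commute to_fract_mult to_fract_power)
  then show ?thesis unfolding nil_def divs_def using B_base by blast
qed

text \<open>Subtracting the element of M leaves a scalar in \<open>nil\<close>, which must be zero
  since nonzero scalars are units.\<close>

lemma nil_M:
  assumes "to_fract r \<in> nil"
  shows "r \<in> M"
proof -
  obtain c where c: "r - \<iota> c \<in> M" using residue unfolding has_residue_field_def by blast
  have "to_fract r - to_fract (r - \<iota> c) \<in> nil" by (intro nil_diff assms M_nil c)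
  then have "\<kappa> c \<in> nil" by (simp add: \<kappa>_def)
  then have *: "\<kappa> (inverse c) * \<kappa> c \<in> nil" by (intro nil_mult B_closed)
  have "c = 0"
  proof (rule ccontr)
    assume "c \<noteq> 0"
    then have "\<kappa> (inverse c) * \<kappa> c = 1" by (simp flip: \<kappa>_simps)
    then show False using * one_not_nil by simp
  qed
  then show ?thesis using c by (simp add: \<iota>_simps)
qed

lemma unitB_\<kappa>: "c \<noteq> 0 \<Longrightarrow> unitB (\<kappa> c)"
proof -
  assume "c \<noteq> 0"
  then have *: "\<kappa> (inverse c) * \<kappa> c = 1" by (simp flip: \<kappa>_simps)
  then have "inverse (\<kappa> c) = \<kappa> (inverse c)" by (metis inverse_unique mult.commute)
  then show ?thesis using * by (auto simp: unitB_def B_\<kappa>)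
qed

lemma unitBI: "a \<in> B \<Longrightarrow> b \<in> B \<Longrightarrow> a * b = 1 \<Longrightarrow> unitB a"
  unfolding unitB_def by (metis inverse_unique mult_zero_left zero_neq_one)

lemma unitB_mult: "unitB a \<Longrightarrow> unitB b \<Longrightarrow> unitB (a * b)"
  by (auto simp: unitB_def B_mult)

lemma unitB_power: "unitB a \<Longrightarrow> unitB (a ^ n)"
  by (induction n) (simp_all add: unitB_mult, simp add: unitB_def B_1)

text \<open>Bridges d-adic and Y-adic convergence: Y divides d^K for some K, so the subsequence with
  indices K i is Cauchy in the Y-adic sense, and the estimates are stated along it.\<close>

lemma nil_limit:
  assumes d: "d \<in> nil" and s: "\<And>n. s n \<in> B" "\<And>n. divs (d ^ n) (s (Suc n) - s n)"
  obtains l K where "l \<in> B" "K > 0" "\<And>i. divs (Y ^ i) (l - s (K * i))" "\<And>i. divs (Y ^ i) (d ^ (K * i))"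
proof -
  have dB: "d \<in> B" by (rule nil_B[OF d])
  obtain K0 where "divs Y (d ^ K0)" using d by (auto simp: nil_def)
  define K where "K = Suc K0"
  have K: "divs Y (d ^ K)" using \<open>divs Y (d ^ K0)\<close> dB by (simp add: K_def divs_mult)
  have dK: "divs (Y ^ i) (d ^ (K * i))" for i
    using divs_power[OF K, of i] by (simp add: power_mult)
  have "\<exists>l\<in>B. \<forall>i. divs (Y ^ i) (l - s (K * i))"
  proof (rule B_complete)
    show "divs (Y ^ i) (s (K * Suc i) - s (K * i))" for i
    proof (rule divs_trans[OF dK])
      show "divs (d ^ (K * i)) (s (K * Suc i) - s (K * i))"
        by (rule telescope[OF s(2) dB]) simp
    qed
  qed (rule s(1))
  then show ?thesis using that[of _ K] dK by (auto simp: K_def)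
qed

text \<open>The inverse is the limit of the geometric series in z.\<close>

lemma unitB_one_minus:
  assumes "z \<in> nil"
  shows "unitB (1 - z)"
proof -
  have zB: "z \<in> B" by (rule nil_B[OF assms])
  define s where "s n = (\<Sum>i<n. z ^ i)" for n
  have sB: "s n \<in> B" for n
    by (induction n) (auto simp: s_def B_0 intro: B_add B_power zB)
  have "divs (z ^ n) (s (Suc n) - s n)" for n
    unfolding divs_def s_def by (intro bexI[OF _ B_1]) simp
  then obtain l K where l: "l \<in> B" "K > 0" "\<And>i. divs (Y ^ i) (l - s (K * i))"
    "\<And>i. divs (Y ^ i) (z ^ (K * i))" using nil_limit[where d = z and s = s, OF assms sB] by blast
  have geo: "(1 - z) * s n = 1 - z ^ n" for n
    by (simp add: s_def one_diff_power_eq)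
  have "(1 - z) * l - 1 = 0"
  proof (rule divs_Y_power_imp_zero)
    fix i
    have "(1 - z) * l - 1 = (1 - z) * (l - s (K * i)) - z ^ (K * i)"
      using geo[of "K * i"] by (simp add: right_diff_distrib)
    also have "divs (Y ^ i) \<dots>"
      by (intro divs_diff divs_mult l B_closed zB)
    finally show "divs (Y ^ i) ((1 - z) * l - 1)" .
  qed
  then show ?thesis using l(1) zB by (intro unitBI[of _ l] B_closed) auto
qed

lemma unitB_add_nil:
  assumes "unitB a" "z \<in> nil"
  shows "unitB (a + z)"
proof -
  have "unitB (1 - inverse a * (- z))"
    using assms by (intro unitB_one_minus nil_mult nil_uminus) (auto simp: unitB_def)
  then have "unitB (a * (1 - inverse a * (- z)))" by (rule unitB_mult[OF assms(1)])
  also have "a * (1 - inverse a * (- z)) = a + z"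
    using assms(1) by (simp add: unitB_def algebra_simps)
  finally show ?thesis .
qed

end

section \<open>Taylor expansion and Hensel's lemma\<close>

lemma poly_in_subring:
  assumes "\<And>i. coeff p i \<in> S" "a \<in> S" "0 \<in> S"
    and "\<And>x y. x \<in> S \<Longrightarrow> y \<in> S \<Longrightarrow> x + y \<in> S" "\<And>x y. x \<in> S \<Longrightarrow> y \<in> S \<Longrightarrow> x * y \<in> S"
  shows "poly p (a :: 'a::comm_ring_1) \<in> S"
  using assms(1)
proof (induction p)
  case (pCons c p)
  have "coeff p i \<in> S" for i using pCons.prems[of "Suc i"] by simp
  moreover have "c \<in> S" using pCons.prems[of 0] by simp
  ultimately show ?case using pCons.IH assms by simp
qed (simp add: assms)

lemma poly_taylor_in_subring:
  fixes a h :: "'a::idom"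
  assumes "\<And>i. coeff p i \<in> S" "a \<in> S" "h \<in> S" "0 \<in> S" "1 \<in> S"
    and S: "\<And>x y. x \<in> S \<Longrightarrow> y \<in> S \<Longrightarrow> x + y \<in> S" "\<And>x y. x \<in> S \<Longrightarrow> y \<in> S \<Longrightarrow> x * y \<in> S"
  shows "\<exists>s\<in>S. poly p (a + h) = poly p a + h * poly (pderiv p) a + h\<^sup>2 * s"
  using assms(1)
proof (induction p)
  case (pCons c p)
  have p: "coeff p i \<in> S" for i using pCons.prems[of "Suc i"] by simp
  then obtain s where s: "s \<in> S" "poly p (a + h) = poly p a + h * poly (pderiv p) a + h\<^sup>2 * s"
    using pCons.IH by blast
  have of_nat: "of_nat n \<in> S" for n by (induction n) (auto simp: assms S)
  have "poly (pderiv p) a \<in> S"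
    by (rule poly_in_subring) (auto simp: coeff_pderiv p assms of_nat S simp del: of_nat_Suc)
  then have "poly (pderiv p) a + (a + h) * s \<in> S" by (intro S assms s)
  moreover have "poly (pCons c p) (a + h) = poly (pCons c p) a + h * poly (pderiv (pCons c p)) a +
      h\<^sup>2 * (poly (pderiv p) a + (a + h) * s)"
    by (simp add: s(2) pderiv_pCons power2_eq_square algebra_simps)
  ultimately show ?case by blast
qed (use assms in auto)

context analytic_branch
begin

text \<open>Newton iteration with modulus d = p(a): the correction h is divisible by d^(n+1) and the
  new value is a multiple of h^2. Of this quadratic gain only one factor d per step is kept, which
  suffices because d lies in \<open>nil\<close>.\<close>

lemma hensel:
  assumes p: "\<And>i. coeff p i \<in> B" and a: "a \<in> B" "poly p a \<in> nil" "unitB (poly (pderiv p) a)"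
  obtains b where "b \<in> B" "poly p b = 0" "b - a \<in> nil"
proof -
  define d where "d = poly p a"
  have dn: "d \<in> nil" and dB: "d \<in> B" using a nil_B by (auto simp: d_def)
  have p': "coeff (pderiv p) i \<in> B" for i
    unfolding coeff_pderiv by (intro B_closed p)
  note taylor = poly_taylor_in_subring[where S = B, OF _ _ _ B_0 B_1 B_add B_mult]
  define P where "P n s \<longleftrightarrow> s \<in> B \<and> divs d (s - a) \<and> divs (d ^ Suc n) (poly p s)" for n s
  define Q where "Q n s s' \<longleftrightarrow> divs (d ^ n) (s' - s)" for n :: nat and s s'
  have "\<exists>s. \<forall>n. P n (s n) \<and> Q n (s n) (s (Suc n))"
  proof (rule dependent_nat_choice)
    have "divs d d" unfolding divs_def by (rule bexI[OF _ B_1]) simp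
    then show "\<exists>s. P 0 s" using a(1) by (intro exI[of _ a]) (simp add: P_def divs_0 d_def)
  next
    fix s n assume "P n s"
    then have s: "s \<in> B" "divs d (s - a)" "divs (d ^ Suc n) (poly p s)" by (auto simp: P_def)
    obtain c where c: "c \<in> B" "s - a = d * c" using s(2) by (auto simp: divs_def)
    have sa: "s - a \<in> nil" unfolding c using nil_mult[OF dn c(1)] by (simp add: mult.commute)
    obtain w where w: "w \<in> B" "poly (pderiv p) (a + (s - a)) = poly (pderiv p) a +
        (s - a) * poly (pderiv (pderiv p)) a + (s - a)\<^sup>2 * w"
      using taylor[OF p' a(1) nil_B[OF sa]] by blast
    have ddB: "poly (pderiv (pderiv p)) a \<in> B"
      by (rule poly_in_subring) (auto simp: coeff_pderiv[of "pderiv p"] p' a B_closed simp del: of_nat_Suc)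
    have "poly (pderiv p) s = poly (pderiv p) a +
        (poly (pderiv (pderiv p)) a + (s - a) * w) * (s - a)"
      using w(2) by (simp add: power2_eq_square algebra_simps)
    then have u: "unitB (poly (pderiv p) s)"
      using unitB_add_nil[OF a(3) nil_mult[OF sa]] ddB w(1) nil_B[OF sa]
      by (simp add: B_closed)
    define h where "h = - (inverse (poly (pderiv p) s) * poly p s)"
    have hd: "divs (d ^ Suc n) h" unfolding h_def
      using u by (intro divs_uminus divs_mult s) (simp add: unitB_def)
    then have hB: "h \<in> B" using dB by (auto simp: divs_def B_closed)
    obtain v where v: "v \<in> B" "poly p (s + h) = poly p s + h * poly (pderiv p) s + h\<^sup>2 * v"
      using taylor[OF p s(1) hB] by blast
    have "h * poly (pderiv p) s = - poly p s" using u by (simp add: h_def unitB_def)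
    then have "poly p (s + h) = v * (h * h)" using v(2) by (simp add: power2_eq_square)
    moreover have "divs (d ^ Suc n * d ^ Suc n) (h * h)" by (rule divs_mult2[OF hd hd])
    moreover have "divs (d ^ Suc (Suc n)) (d ^ Suc n * d ^ Suc n)"
      unfolding power_add[symmetric] by (rule divs_power_le[OF dB]) simp
    ultimately have 1: "divs (d ^ Suc (Suc n)) (poly p (s + h))"
      using divs_mult[OF _ v(1)] divs_trans by metis
    have "divs (d ^ 1) h" using divs_trans[OF divs_power_le[OF dB] hd, of 1] by simp
    then have 2: "divs d (s + h - a)" using divs_add[OF s(2)] by (simp add: algebra_simps)
    have "divs (d ^ n) h" using divs_trans[OF divs_power_le[OF dB] hd, of n] by simp
    then have "Q n s (s + h)" by (simp add: Q_def)
    then show "\<exists>s'. P (Suc n) s' \<and> Q n s s'"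
      using 1 2 s(1) hB by (intro exI[of _ "s + h"]) (simp add: P_def B_add del: power_Suc)
  qed
  then obtain s where s: "\<And>n. P n (s n)" "\<And>n. Q n (s n) (s (Suc n))" by blast
  have sB: "s n \<in> B" for n using s(1) by (simp add: P_def)
  obtain l K where l: "l \<in> B" "K > 0" "\<And>i. divs (Y ^ i) (l - s (K * i))"
    "\<And>i. divs (Y ^ i) (d ^ (K * i))"
    using nil_limit[where d = d and s = s, OF dn sB] s(2) unfolding Q_def by blast
  have "poly p l = 0"
  proof (rule divs_Y_power_imp_zero)
    fix i
    \<comment> \<open>Taylor expansion at s_m: both p(s_m) and the increment l - s_m are divisible
      by Y^i.\<close>
    define m where "m = K * i"
    have lsB: "l - s m \<in> B" by (intro B_closed l sB)
    obtain v where v: "v \<in> B" "poly p (s m + (l - s m)) =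
        poly p (s m) + (l - s m) * poly (pderiv p) (s m) + (l - s m)\<^sup>2 * v"
      using taylor[OF p sB lsB] by blast
    have "poly (pderiv p) (s m) \<in> B" by (rule poly_in_subring) (auto simp: p' sB B_closed)
    then have "divs (Y ^ i) ((poly (pderiv p) (s m) + (l - s m) * v) * (l - s m))"
      using l(3) unfolding m_def by (intro divs_mult B_closed v(1) l(1) sB) (simp_all add: m_def)
    moreover have "divs (Y ^ i) (poly p (s m))"
    proof (rule divs_trans[OF l(4)])
      have "divs (d ^ Suc m) (poly p (s m))" using s(1) by (simp add: P_def del: power_Suc)
      then show "divs (d ^ (K * i)) (poly p (s m))"
        using divs_trans[OF divs_power_le[OF dB]] by (metis le_SucI m_def order_refl)
    qed
    ultimately have "divs (Y ^ i) (poly p (s m) + (poly (pderiv p) (s m) + (l - s m) * v) * (l - s m))"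
      by (intro divs_add)
    also have "poly p (s m) + (poly (pderiv p) (s m) + (l - s m) * v) * (l - s m) = poly p l"
      using v(2) by (simp add: power2_eq_square algebra_simps)
    finally show "divs (Y ^ i) (poly p l)" .
  qed
  moreover have "l - a \<in> nil"
  proof -
    have "divs (Y ^ 1) (l - s (K * 1))" by (rule l(3))
    then have "l - s K \<in> nil" by (intro nil_divs B_closed l sB) simp
    moreover have "s K - a \<in> nil"
    proof -
      have "divs d (s K - a)" using s(1) by (simp add: P_def)
      then show ?thesis using nil_mult[OF dn] by (auto simp: divs_def mult.commute)
    qed
    ultimately show ?thesis using nil_add by fastforce
  qed
  ultimately show ?thesis using that l(1) by blast
qed

end

section \<open>The integral closure is a discrete valuation ring\<close>

lemma poly_map_poly_hom_mult:
  assumes "h 0 = 0" "\<And>a b. h (a + b) = h a + h b" "\<And>a b. h (a * b) = h a * h b"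
  shows "poly (map_poly h (p * q)) x = poly (map_poly h p) x * poly (map_poly h q) (x :: 'a::comm_ring_1)"
proof (induction p)
  case (pCons a p)
  have add: "map_poly h (p + q) = map_poly h p + map_poly h q" for p q
    by (rule poly_eqI) (simp add: coeff_map_poly assms)
  show ?case using assms(1,3)
    by (simp add: pCons.IH add map_poly_smult map_poly_pCons algebra_simps)
qed (simp add: assms)

context analytic_branch
begin

definition eval\<kappa> :: "'k poly \<Rightarrow> 'r fract \<Rightarrow> 'r fract"
  where "eval\<kappa> g a = poly (map_poly \<kappa> g) a"

lemma eval\<kappa>_pCons: "eval\<kappa> (pCons c g) a = \<kappa> c + a * eval\<kappa> g a"
  by (simp add: eval\<kappa>_def map_poly_pCons \<kappa>_simps)

lemma eval\<kappa>_0: "eval\<kappa> 0 a = 0"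
  by (simp add: eval\<kappa>_def)

lemma eval\<kappa>_mult: "eval\<kappa> (g * h) a = eval\<kappa> g a * eval\<kappa> h a"
  unfolding eval\<kappa>_def by (rule poly_map_poly_hom_mult) (simp_all add: \<kappa>_simps)

lemma eval\<kappa>_B: "a \<in> B \<Longrightarrow> eval\<kappa> g a \<in> B"
  by (induction g) (simp_all add: eval\<kappa>_0 eval\<kappa>_pCons B_closed)

text \<open>Replacing the coefficients of an integral equation by their residues changes its value
  at a only by elements of \<open>nil\<close>, and the leading coefficient stays nonzero. So a is
  algebraic over k modulo \<open>nil\<close>.\<close>

lemma eval\<kappa>_nil:
  assumes "a \<in> B"
  obtains g where "g \<noteq> 0" "eval\<kappa> g a \<in> nil"
proof -
  obtain p :: "'r poly" where p: "lead_coeff p = 1" "poly (map_poly to_fract p) a = 0"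
    using assms by (auto simp: integral_closure_def)
  define \<rho> where "\<rho> r = (SOME c. r - \<iota> c \<in> M)" for r
  have \<rho>: "r - \<iota> (\<rho> r) \<in> M" for r
    unfolding \<rho>_def by (rule someI_ex) (use residue in \<open>auto simp: has_residue_field_def\<close>)
  have \<rho>_0: "\<rho> 0 = 0"
    using \<iota>_in_M[of "- \<rho> 0"] \<rho>[of 0] by (simp add: \<iota>_simps)
  have \<rho>_1: "\<rho> 1 \<noteq> 0"
  proof
    assume "\<rho> 1 = 0"
    then have "\<iota> 1 \<in> M" using \<rho>[of 1] by (simp add: \<iota>_simps)
    then show False using \<iota>_in_M[of 1] by simp
  qed
  have diff: "poly (map_poly to_fract p) a - eval\<kappa> (map_poly \<rho> p) a \<in> nil" for p
  proof (induction p)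
    case (pCons r p)
    have eq: "poly (map_poly to_fract (pCons r p)) a - eval\<kappa> (map_poly \<rho> (pCons r p)) a =
        to_fract (r - \<iota> (\<rho> r)) + a * (poly (map_poly to_fract p) a - eval\<kappa> (map_poly \<rho> p) a)"
      by (simp add: map_poly_pCons \<rho>_0 eval\<kappa>_pCons \<kappa>_def algebra_simps)
    show ?case unfolding eq by (intro nil_add M_nil \<rho> nil_mult pCons.IH assms)
  qed (simp add: eval\<kappa>_0 nil_0)
  have "eval\<kappa> (map_poly \<rho> p) a \<in> nil"
    using nil_uminus[OF diff[of p]] p(2) by simp
  moreover have "coeff (map_poly \<rho> p) (degree p) \<noteq> 0"
    using p(1) \<rho>_1 by (simp add: coeff_map_poly \<rho>_0)
  ultimately show ?thesis using that[of "map_poly \<rho> p"] by force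
qed

lemma eval\<kappa>_factor:
  "g \<noteq> 0 \<Longrightarrow> \<exists>m c h. c \<noteq> 0 \<and> (\<forall>a. eval\<kappa> g a = a ^ m * (\<kappa> c + a * eval\<kappa> h a))"
proof (induction g)
  case (pCons c g)
  show ?case
  proof (cases "c = 0")
    case False
    then show ?thesis by (intro exI[of _ 0] exI[of _ c] exI[of _ g]) (simp add: eval\<kappa>_pCons)
  next
    case True
    then have "g \<noteq> 0" using pCons.prems by simp
    then obtain m d h where "d \<noteq> 0" "\<forall>a. eval\<kappa> g a = a ^ m * (\<kappa> d + a * eval\<kappa> h a)"
      using pCons.IH by blast
    then show ?thesis using True
      by (intro exI[of _ "Suc m"] exI[of _ d] exI[of _ h]) (simp add: eval\<kappa>_pCons \<kappa>_simps mult.assoc)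
  qed
qed simp

text \<open>
  If \<open>a\<close> were neither nilpotent nor a unit modulo \<open>nil\<close>, some multiple \<open>u\<close> of \<open>a\<close> would be a
  nontrivial idempotent there, and by Hensel's lemma it would lift to one in a domain.
\<close>

lemma nil_or_unit:
  assumes a: "a \<in> B"
  shows "a \<in> nil \<or> unitB a"
proof -
  obtain g where g: "g \<noteq> 0" "eval\<kappa> g a \<in> nil" using eval\<kappa>_nil[OF a] .
  obtain m c h where h: "c \<noteq> 0" "\<And>a. eval\<kappa> g a = a ^ m * (\<kappa> c + a * eval\<kappa> h a)"
    using eval\<kappa>_factor[OF g(1)] by blast
  have uc: "unitB (\<kappa> c)" by (rule unitB_\<kappa>[OF h(1)])
  \<comment> \<open>Chosen so that g(a) is \<open>\<kappa> c\<close> times a^m (1 - a w); the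
    product u = a w is then idempotent modulo \<open>nil\<close>.\<close>
  define w where "w = - (inverse (\<kappa> c) * eval\<kappa> h a)"
  have wB: "w \<in> B" unfolding w_def
    using uc by (intro B_uminus B_mult eval\<kappa>_B a) (simp add: unitB_def)
  define u where "u = a * w"
  have uB: "u \<in> B" unfolding u_def by (intro B_mult a wB)
  have "inverse (\<kappa> c) * eval\<kappa> g a \<in> nil"
    using uc by (intro nil_mult g) (simp add: unitB_def)
  also have "inverse (\<kappa> c) * eval\<kappa> g a = a ^ m * (1 - u)"
    using uc unfolding h(2) u_def w_def by (simp add: unitB_def field_simps)
  finally have am: "a ^ m * (1 - u) \<in> nil" .
  have "(w ^ m * u * (1 - u) ^ m) * (a ^ m * (1 - u)) \<in> nil"
    by (intro nil_mult am B_closed wB uB)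
  also have "(w ^ m * u * (1 - u) ^ m) * (a ^ m * (1 - u)) = (u * (1 - u)) ^ Suc m"
    unfolding power_mult_distrib power_Suc u_def by (simp only: mult_ac power_mult_distrib)
  finally have "u * (1 - u) \<in> nil" by (rule nil_power_imp[rotated]) (intro B_closed uB)
  then have idem: "u\<^sup>2 - u \<in> nil" using nil_uminus by (fastforce simp: power2_eq_square algebra_simps)
  \<comment> \<open>The derivative of T^2 - T at u is 2 u - 1. Its square is 1 modulo
    \<open>nil\<close>, so it is a unit and Hensel's lemma applies.\<close>
  have "(2 * u - 1) * (2 * u - 1) = 1 + 4 * (u\<^sup>2 - u)"
    by (simp add: power2_eq_square algebra_simps)
  moreover have "unitB (1 + 4 * (u\<^sup>2 - u))"
  proof (rule unitB_add_nil)
    show "unitB 1" using unitB_power[OF uc, of 0] by simp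
    have "of_nat 4 * (u\<^sup>2 - u) \<in> nil" by (intro nil_mult idem B_of_nat)
    then show "4 * (u\<^sup>2 - u) \<in> nil" by simp
  qed
  ultimately have sq: "unitB ((2 * u - 1) * (2 * u - 1))" by simp
  have uB2: "2 * u - 1 \<in> B" using B_of_nat[of 2] by (intro B_closed uB) simp
  have "unitB (2 * u - 1)"
  proof (rule unitBI[OF uB2])
    show "(2 * u - 1) * inverse ((2 * u - 1) * (2 * u - 1)) \<in> B"
      using sq by (intro B_mult uB2) (simp add: unitB_def)
    show "(2 * u - 1) * ((2 * u - 1) * inverse ((2 * u - 1) * (2 * u - 1))) = 1"
      using sq by (metis mult.assoc right_inverse unitB_def)
  qed
  moreover have "coeff [:0, - 1, 1:] i \<in> B" for i
    by (auto simp: coeff_pCons B_closed split: nat.splits)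
  moreover have "poly [:0, - 1, 1:] u \<in> nil"
    using idem by (simp add: power2_eq_square algebra_simps)
  moreover have "poly (pderiv [:0, - 1, 1:]) u = 2 * u - 1"
    by (simp add: pderiv_pCons)
  ultimately obtain e where e: "e \<in> B" "poly [:0, - 1, 1:] e = 0" "e - u \<in> nil"
    using hensel[of "[:0, - 1, 1:]" u] uB by metis
  then have "e * (e - 1) = 0" by (simp add: algebra_simps)
  then consider "e = 0" | "e = 1" by auto
  then show ?thesis
  proof cases
    case 1
    then have "u \<in> nil" using nil_uminus[OF e(3)] by simp
    then have "unitB (1 - u)" by (rule unitB_one_minus)
    then have "inverse (1 - u) * (a ^ m * (1 - u)) \<in> nil" by (intro nil_mult am) (simp add: unitB_def)
    also have "inverse (1 - u) * (a ^ m * (1 - u)) = a ^ m"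
      using \<open>unitB (1 - u)\<close> by (simp add: unitB_def)
    finally show ?thesis using nil_power_imp[OF a] by blast
  next
    case 2
    then have "unitB (1 - (1 - u))" using e(3) by (intro unitB_one_minus) simp
    then have "unitB u" by simp
    then have "a * (w * inverse u) = 1" and "inverse u \<in> B"
      unfolding unitB_def u_def by (metis mult.assoc right_inverse, blast)
    then have "unitB a" by (intro unitBI[OF a, of "w * inverse u"] B_mult wB)
    then show ?thesis ..
  qed
qed

text \<open>Modulo \<open>nil\<close>, b is a root of a nonzero polynomial over the algebraically
  closed k. A linear factor evaluated at b lies in \<open>nil\<close> or is a unit; in the latter
  case it cancels and the degree drops.\<close>

lemma residue_B:
  assumes b: "b \<in> B"
  shows "\<exists>c. b - \<kappa> c \<in> nil"
proof -
  have "\<exists>c. b - \<kappa> c \<in> nil" if "g \<noteq> 0" "eval\<kappa> g b \<in> nil" for g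
    using that
  proof (induction "degree g" arbitrary: g rule: less_induct)
    case less
    have "degree g > 0"
    proof (rule ccontr)
      assume "\<not> degree g > 0"
      then obtain c where c: "g = [:c:]" by (metis degree_eq_zeroE gr_zeroI)
      then show False using less.prems nil_not_unit[OF unitB_\<kappa>] by (simp add: eval\<kappa>_pCons eval\<kappa>_0)
    qed
    then obtain c where "poly g c = 0" using alg_closed_imp_poly_has_root by blast
    then obtain h where h: "g = [:- c, 1:] * h" by (metis dvdE poly_eq_0_iff_dvd)
    then have "h \<noteq> 0" using less.prems by auto
    have "eval\<kappa> g b = (b - \<kappa> c) * eval\<kappa> h b"
      unfolding h eval\<kappa>_mult by (simp add: eval\<kappa>_pCons eval\<kappa>_0 \<kappa>_simps)
    then have nil: "(b - \<kappa> c) * eval\<kappa> h b \<in> nil" using less.prems by simp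
    have "b - \<kappa> c \<in> B" by (intro B_closed b)
    then consider "b - \<kappa> c \<in> nil" | "unitB (b - \<kappa> c)" using nil_or_unit by blast
    then show ?case
    proof cases
      case 2
      then have "inverse (b - \<kappa> c) * ((b - \<kappa> c) * eval\<kappa> h b) \<in> nil"
        by (intro nil_mult nil) (simp add: unitB_def)
      then have "eval\<kappa> h b \<in> nil" using 2 by (simp add: unitB_def flip: mult.assoc)
      moreover have "degree h < degree g" unfolding h using \<open>h \<noteq> 0\<close> by (subst degree_mult_eq) auto
      ultimately show ?thesis using less.hyps \<open>h \<noteq> 0\<close> by blast
    qed blast
  qed
  then show ?thesis using eval\<kappa>_nil[OF b] by metis
qed

text \<open>Hensel's lemma for T^e - u, started at a scalar e-th root r of the residue of u; the
  derivative e r^(e-1) is nonzero in characteristic zero.\<close>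

lemma unitB_root:
  assumes u: "unitB u" and e: "e > 0"
  obtains w where "unitB w" "w ^ e = u"
proof -
  have uB: "u \<in> B" using u by (simp add: unitB_def)
  obtain c where c: "u - \<kappa> c \<in> nil" using residue_B[OF uB] by blast
  have "c \<noteq> 0" using c nil_not_unit[OF u] by (auto simp: \<kappa>_simps)
  obtain r where r: "r ^ e = c" using nth_root_exists[OF e] by blast
  then have "r \<noteq> 0" using \<open>c \<noteq> 0\<close> e by auto
  define p where "p = monom 1 e - [:u:]"
  have "coeff p i \<in> B" for i
    by (auto simp: p_def coeff_pCons B_closed uB split: nat.splits)
  moreover have "poly p (\<kappa> r) \<in> nil"
  proof -
    have "poly p (\<kappa> r) = \<kappa> (r ^ e) - u" unfolding \<kappa>_simps by (simp add: p_def poly_monom)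
    then show ?thesis using nil_uminus[OF c] by (simp add: r)
  qed
  moreover have "unitB (poly (pderiv p) (\<kappa> r))"
  proof -
    have "poly (pderiv p) (\<kappa> r) = \<kappa> (of_nat e * r ^ (e - 1))"
      by (simp add: p_def pderiv_diff pderiv_monom pderiv_pCons poly_monom \<kappa>_simps)
    moreover have "of_nat e * r ^ (e - 1) \<noteq> 0" using e \<open>r \<noteq> 0\<close> by simp
    ultimately show ?thesis using unitB_\<kappa> by metis
  qed
  ultimately obtain b where b: "b \<in> B" "poly p b = 0" using hensel[OF _ B_\<kappa>] by metis
  then have be: "b ^ e = u" by (simp add: p_def poly_monom)
  have "b * b ^ (e - 1) = u" using be e by (simp flip: power_Suc)
  then have "unitB b"
    using u b(1) by (intro unitBI[of b "b ^ (e - 1) * inverse u"] B_closed)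
      (auto simp: unitB_def simp flip: mult.assoc)
  then show ?thesis using that be by blast
qed

text \<open>X times \<open>nil\<close> is an ideal of R, and its generators divided by X generate
  \<open>nil\<close> over R. Generation is stated as the fact that annihilation modulo Y can be
  tested on T.\<close>

lemma nil_finitely_generated:
  obtains T where "finite T" "T \<subseteq> nil"
    "\<And>z a. (\<And>b. b \<in> T \<Longrightarrow> divs Y (z * b)) \<Longrightarrow> a \<in> nil \<Longrightarrow> divs Y (z * a)"
proof -
  define I where "I = {r. to_fract r / X \<in> nil}"
  have "is_ideal I"
  proof (rule idl.subspaceI)
    show "0 \<in> I" by (simp add: I_def nil_0)
    show "x + y \<in> I" if "x \<in> I" "y \<in> I" for x y
      using that nil_add by (auto simp: I_def add_divide_distrib)
    show "c * x \<in> I" if "x \<in> I" for c x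
      using that nil_mult[OF _ B_base[of c], of "to_fract x / X"] by (simp add: I_def)
  qed
  then obtain S where S: "finite S" "I = ideal_gen S" using noeth by (auto simp: noetherian_def)
  define T where "T = (\<lambda>r. to_fract r / X) ` S"
  show ?thesis
  proof (rule that)
    show "finite T" using S by (simp add: T_def)
    show "T \<subseteq> nil" using S idl.span_superset[of S] by (auto simp: T_def I_def)
    fix z a assume z: "\<And>b. b \<in> T \<Longrightarrow> divs Y (z * b)" and a: "a \<in> nil"
    have "ideal_gen S \<subseteq> {r. divs Y (z * (to_fract r / X))}"
    proof (rule idl.span_minimal)
      show "S \<subseteq> {r. divs Y (z * (to_fract r / X))}"
      proof clarify
        show "divs Y (z * (to_fract r / X))" if "r \<in> S" for r
          by (rule z) (use that in \<open>auto simp: T_def\<close>)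
      qed
      show "is_ideal {r. divs Y (z * (to_fract r / X))}"
      proof (rule idl.subspaceI)
        show "0 \<in> {r. divs Y (z * (to_fract r / X))}" by (simp add: divs_0)
        show "x + y \<in> {r. divs Y (z * (to_fract r / X))}"
          if "x \<in> {r. divs Y (z * (to_fract r / X))}" "y \<in> {r. divs Y (z * (to_fract r / X))}" for x y
          using that divs_add by (auto simp: add_divide_distrib distrib_left)
        show "c * x \<in> {r. divs Y (z * (to_fract r / X))}"
          if "x \<in> {r. divs Y (z * (to_fract r / X))}" for c x
          using that divs_mult[OF _ B_base[of c], of Y "z * (to_fract x / X)"] by (simp add: mult_ac)
      qed
    qed
    moreover obtain r where r: "X * a = to_fract r" using x0(2)[OF nil_B[OF a]] by blast
    moreover have "a = to_fract r / X" using x0(1) by (simp flip: r)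
    ultimately show "divs Y (z * a)" using a S(2) by (auto simp: I_def)
  qed
qed

text \<open>Start with 1 and, for each generator a of \<open>nil\<close> in turn, multiply by the
  last power of a that keeps the product nonzero modulo Y. Generators treated earlier still
  annihilate the result.\<close>

lemma socle:
  obtains z where "z \<in> B" "\<not> divs Y z" "\<And>a. a \<in> nil \<Longrightarrow> divs Y (z * a)"
proof -
  obtain T where T: "finite T" "T \<subseteq> nil"
    "\<And>z a. (\<And>b. b \<in> T \<Longrightarrow> divs Y (z * b)) \<Longrightarrow> a \<in> nil \<Longrightarrow> divs Y (z * a)"
    by (rule nil_finitely_generated) blast
  have "\<exists>z\<in>B. \<not> divs Y z \<and> (\<forall>b\<in>T. divs Y (z * b))"
    using T(1,2)
  proof (induction T rule: finite_induct)
    case empty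
    have "\<not> divs Y 1" using nil_divs[OF B_1] one_not_nil by blast
    then show ?case using B_1 by auto
  next
    case (insert a T)
    then obtain z where z: "z \<in> B" "\<not> divs Y z" "\<forall>b\<in>T. divs Y (z * b)" by auto
    have aB: "a \<in> B" using insert nil_B by auto
    obtain N where "divs Y (a ^ N)" using insert by (auto simp: nil_def)
    then have N: "divs Y (z * a ^ N)" by (rule divs_mult[OF _ z(1)])
    define k where "k = (LEAST k. divs Y (z * a ^ k))"
    have k: "divs Y (z * a ^ k)" unfolding k_def by (rule LeastI[of _ N]) (rule N)
    then have "k \<noteq> 0" using z(2) by (metis mult_1_right power_0)
    then obtain j where j: "k = Suc j" using not0_implies_Suc by blast
    have "\<not> divs Y (z * a ^ j)"
      using not_less_Least[of j "\<lambda>k. divs Y (z * a ^ k)"] j by (auto simp: k_def)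
    moreover have "divs Y (z * a ^ j * b)" if "b \<in> insert a T" for b
    proof (cases "b = a")
      case True
      then show ?thesis using k by (simp add: j mult_ac)
    next
      case False
      then have "divs Y (z * b)" using that z(3) by blast
      then have "divs Y (a ^ j * (z * b))" by (rule divs_mult[OF _ B_power[OF aB]])
      then show ?thesis by (simp add: mult_ac)
    qed
    ultimately show ?case using B_mult[OF z(1) B_power[OF aB]] by blast
  qed
  then show ?thesis using T(3) that by blast
qed

section \<open>Uniformizers and the order of an element\<close>

definition uniformizer :: "'r fract \<Rightarrow> bool"
  where "uniformizer t \<longleftrightarrow> t \<in> nil \<and> (\<forall>b\<in>nil. divs t b)"

text \<open>The fraction q = z/Y multiplies \<open>nil\<close> into B but lies outside B. If it
  mapped \<open>nil\<close> to itself, all q^n Y would lie in B, \<open>x0 * y0\<close> would be a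
  common denominator and q would be integral. So q a is a unit for some a in \<open>nil\<close>, and
  a divides each b there with quotient q b / (q a).\<close>

lemma uniformizer_exists: "\<exists>t. uniformizer t"
proof -
  obtain z where z: "z \<in> B" "\<not> divs Y z" "\<And>a. a \<in> nil \<Longrightarrow> divs Y (z * a)" by (rule socle) blast
  have Y0: "Y \<noteq> 0" using y0 by simp
  define q where "q = z / Y"
  have qB: "q * a \<in> B" if "a \<in> nil" for a
    using z(3)[OF that] Y0 by (auto simp: divs_def q_def)
  have "q \<notin> B"
  proof
    assume "q \<in> B"
    then have "divs Y z" unfolding divs_def using Y0 by (intro bexI[of _ q]) (simp_all add: q_def)
    then show False using z by simp
  qed
  have "\<exists>a\<in>nil. q * a \<notin> nil"
  proof (rule ccontr)
    assume "\<not> ?thesis"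
    then have *: "q * a \<in> nil" if "a \<in> nil" for a using that by blast
    have "q ^ n * Y \<in> nil" for n by (induction n) (simp_all add: Y_nil * mult.assoc)
    then have "X * (q ^ n * Y) \<in> range to_fract" for n using x0(2) nil_B by blast
    then have "to_fract (x0 * y0) * q ^ n \<in> range to_fract" for n by (simp add: mult_ac)
    then have "q \<in> B" using x0(1) y0(2)
      by (intro common_denominator_imp_integral[OF noeth, of "x0 * y0"]) simp_all
    then show False using \<open>q \<notin> B\<close> by simp
  qed
  then obtain a where a: "a \<in> nil" "q * a \<notin> nil" by blast
  then have u: "unitB (q * a)" using nil_or_unit[OF qB] by blast
  have "divs a b" if "b \<in> nil" for b
  proof -
    have "b = a * (q * b * inverse (q * a))" using u by (auto simp: unitB_def field_simps)
    moreover have "q * b * inverse (q * a) \<in> B" using qB[OF that] u by (auto simp: unitB_def B_mult)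
    ultimately show ?thesis unfolding divs_def by blast
  qed
  then show ?thesis using a(1) by (auto simp: uniformizer_def)
qed

lemma uniformizer_nonzero: "uniformizer t \<Longrightarrow> t \<noteq> 0"
  using Y_nil y0(2) by (auto simp: uniformizer_def divs_def)

lemma uniformizer_factor:
  assumes t: "uniformizer t" and b: "b \<in> B" "b \<noteq> 0"
  obtains u n where "unitB u" "b = u * t ^ n"
proof -
  have tn: "t \<in> nil" and tB: "t \<in> B" using t nil_B by (auto simp: uniformizer_def)
  obtain K where K: "divs Y (t ^ K)" using tn by (auto simp: nil_def)
  \<comment> \<open>Since Y divides t^K, divisibility by all powers of t would imply divisibility by
    all powers of Y.\<close>
  have "\<exists>n. \<not> divs (t ^ n) b"
  proof (rule ccontr)
    assume "\<not> ?thesis"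
    then have "divs (Y ^ i) b" for i
      using divs_trans[OF divs_power[OF K, of i], of b] by (simp flip: power_mult)
    then show False using divs_Y_power_imp_zero b(2) by blast
  qed
  then obtain N where N: "\<not> divs (t ^ N) b" by blast
  define n where "n = (LEAST n. \<not> divs (t ^ n) b)"
  have n: "\<not> divs (t ^ n) b" unfolding n_def by (rule LeastI[of _ N]) (rule N)
  then have "n \<noteq> 0" using divs_1[OF b(1)] by (metis power_0)
  then obtain j where j: "n = Suc j" using not0_implies_Suc by blast
  have "divs (t ^ j) b"
    using not_less_Least[of j "\<lambda>n. \<not> divs (t ^ n) b"] j by (auto simp: n_def)
  then obtain c where c: "c \<in> B" "b = t ^ j * c" by (auto simp: divs_def)
  have "c \<notin> nil"
  proof
    assume "c \<in> nil"
    then have "divs t c" using t by (auto simp: uniformizer_def)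
    moreover have "divs (t ^ j) (t ^ j)" unfolding divs_def by (rule bexI[OF _ B_1]) simp
    ultimately have "divs (t * t ^ j) (c * t ^ j)" by (intro divs_mult2)
    then show False using n by (simp add: j c mult.commute)
  qed
  then have "unitB c" using nil_or_unit[OF c(1)] by blast
  then show ?thesis using that[of c j] c by (simp add: mult.commute)
qed

lemma uniformizer_order:
  assumes t: "uniformizer t" and u: "unitB u" and d: "divs (t ^ m) (u * t ^ n)"
  shows "m \<le> n"
proof (rule ccontr)
  assume "\<not> m \<le> n"
  then obtain k where "m = Suc (n + k)" using less_imp_Suc_add by (metis not_le)
  moreover obtain b where b: "b \<in> B" "u * t ^ n = t ^ m * b" using d by (auto simp: divs_def)
  ultimately have "t ^ n * u = t ^ n * (t ^ k * b * t)" by (simp add: power_add mult_ac)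
  then have "u = t ^ k * b * t" using uniformizer_nonzero[OF t] by simp
  moreover have "t ^ k * b * t \<in> nil"
    using t nil_B b(1) by (intro nil_mult B_closed) (auto simp: uniformizer_def)
  ultimately show False using nil_not_unit[OF u] by simp
qed

lemma uniformizer_unit_mult:
  assumes t: "uniformizer t" and w: "unitB w"
  shows "uniformizer (w * t)"
  unfolding uniformizer_def
proof (intro conjI ballI)
  show "w * t \<in> nil" using t w by (intro nil_mult) (auto simp: uniformizer_def unitB_def)
  fix b assume "b \<in> nil"
  then obtain c where c: "c \<in> B" "b = t * c" using t by (auto simp: uniformizer_def divs_def)
  then have "b = w * t * (inverse w * c)" using w by (simp add: unitB_def)
  then show "divs (w * t) b" unfolding divs_def using w c(1) B_mult by (auto simp: unitB_def)
qed

text \<open>The exponent e is the least order of a nonzero element of M. Such an element is u s^e,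
  and absorbing an e-th root of the unit u into s makes it exactly t^e without changing any
  order.\<close>

lemma uniformizer_power_in_M:
  obtains t e y where "uniformizer t" "e > 0" "y \<in> M" "to_fract y = t ^ e"
    "\<And>r. r \<in> M \<Longrightarrow> divs (t ^ e) (to_fract r)"
proof -
  obtain s where s: "uniformizer s" using uniformizer_exists by blast
  define P where "P n \<longleftrightarrow> (\<exists>y\<in>M. \<exists>u. unitB u \<and> to_fract y = u * s ^ n)" for n
  obtain u n where "unitB u" "Y = u * s ^ n"
    using uniformizer_factor[OF s B_base[of y0]] y0(2) by auto
  then have Pn: "P n" using y0(1) by (auto simp: P_def)
  define e where "e = (LEAST n. P n)"
  have "P e" unfolding e_def by (rule LeastI[where P = P, OF Pn])
  have least: "e \<le> n" if "P n" for n unfolding e_def by (rule Least_le[of P, OF that])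
  obtain y u where y: "y \<in> M" "unitB u" "to_fract y = u * s ^ e" using \<open>P e\<close> by (auto simp: P_def)
  have e: "e > 0"
  proof (rule ccontr)
    assume "\<not> e > 0"
    then have "unitB (to_fract y)" using y by simp
    then show False using nil_not_unit M_nil[OF y(1)] by blast
  qed
  obtain w where w: "unitB w" "w ^ e = u" by (rule unitB_root[OF y(2) e])
  define t where "t = w * s"
  have t: "uniformizer t" unfolding t_def by (rule uniformizer_unit_mult[OF s w(1)])
  have tB: "t \<in> B" using t nil_B by (auto simp: uniformizer_def)
  have "divs (t ^ e) (to_fract r)" if "r \<in> M" for r
  proof (cases "r = 0")
    case False
    then obtain v n where v: "unitB v" "to_fract r = v * t ^ n"
      using uniformizer_factor[OF t B_base[of r]] by auto
    then have "to_fract r = (v * w ^ n) * s ^ n" by (simp add: t_def power_mult_distrib)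
    moreover have "unitB (v * w ^ n)" by (intro unitB_mult unitB_power v w)
    ultimately have "P n" using that unfolding P_def by blast
    then have "divs (t ^ e) (t ^ n)" using divs_power_le[OF tB] least by blast
    then show ?thesis using divs_mult v by (auto simp: unitB_def)
  qed (simp add: divs_0)
  moreover have "to_fract y = t ^ e" using y w by (simp add: t_def power_mult_distrib)
  ultimately show ?thesis using that t e y(1) by blast
qed

text \<open>Here R = B and a uniformizer generates M; embedding dimension at least two excludes this
  case.\<close>

lemma maximal_ideal_principal:
  assumes "B \<subseteq> range to_fract"
  shows "\<exists>\<tau>. M = ideal_gen {\<tau>}"
proof -
  obtain t where t: "uniformizer t" using uniformizer_exists by blast
  then have tn: "t \<in> nil" by (simp add: uniformizer_def)
  obtain \<tau> where \<tau>: "t = to_fract \<tau>" using assms nil_B[OF tn] by blast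
  have "\<tau> \<in> M" using tn \<tau> nil_M by simp
  have "M \<subseteq> ideal_gen {\<tau>}"
  proof
    fix r assume "r \<in> M"
    then have "divs t (to_fract r)" using t M_nil by (auto simp: uniformizer_def)
    then obtain b where b: "b \<in> B" "to_fract r = t * b" by (auto simp: divs_def)
    then obtain s where "b = to_fract s" using assms by blast
    then have "to_fract r = to_fract (s * \<tau>)" using b \<tau> by (simp add: mult.commute)
    then have "r = s * \<tau>" by (simp only: to_fract_eq_iff)
    then show "r \<in> ideal_gen {\<tau>}" by (auto simp: idl.span_singleton)
  qed
  moreover have "ideal_gen {\<tau>} \<subseteq> M" using \<open>\<tau> \<in> M\<close> M_ideal by (intro idl.span_minimal) auto
  ultimately show ?thesis by blast
qed

section \<open>Orders in the square of the maximal ideal, and the conductor\<close>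

lemma M_square_order:
  assumes "\<And>r. r \<in> M \<Longrightarrow> divs d (to_fract r)" "s \<in> ideal_power M 2"
  shows "divs (d * d) (to_fract s)"
proof -
  have "ideal_power M 2 \<subseteq> {s. divs (d * d) (to_fract s)}"
    unfolding ideal_power_2[OF M_ideal]
  proof (rule idl.span_minimal)
    show "{a * b |a b. a \<in> M \<and> b \<in> M} \<subseteq> {s. divs (d * d) (to_fract s)}"
      using assms(1) by (auto intro!: divs_mult2)
    show "is_ideal {s. divs (d * d) (to_fract s)}"
      by (rule idl.subspaceI) (auto intro: divs_0 divs_add divs_mult B_base)
  qed
  then show ?thesis using assms(2) by blast
qed

text \<open>Since B = k + t B, an element of t^j B is a scalar multiple of t^j plus a remainder in
  t^(j+1) B. The descent is applied with S the image of M^2 and with S the image of R.\<close>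

lemma B_downward:
  assumes t: "uniformizer t" and bc: "b \<le> c"
    and S: "\<And>x y. x \<in> S \<Longrightarrow> y \<in> S \<Longrightarrow> x + y \<in> S" "\<And>x a. x \<in> S \<Longrightarrow> \<kappa> a * x \<in> S"
    and top: "\<And>a. a \<in> B \<Longrightarrow> t ^ c * a \<in> S"
    and pow: "\<And>j. b \<le> j \<Longrightarrow> t ^ j \<in> S"
  shows "a \<in> B \<Longrightarrow> t ^ b * a \<in> S"
  using bc pow
proof (induction arbitrary: a rule: inc_induct)
  case base
  then show ?case using top by blast
next
  case (step j)
  obtain r where "a - \<kappa> r \<in> nil" using residue_B step.prems by blast
  then obtain a' where a': "a' \<in> B" "a - \<kappa> r = t * a'" using t by (auto simp: uniformizer_def divs_def)
  have "t ^ j * a = \<kappa> r * t ^ j + t ^ Suc j * a'"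
  proof -
    have "a = \<kappa> r + t * a'" using a'(2) by (simp add: algebra_simps)
    then show ?thesis by (simp add: algebra_simps)
  qed
  also have "\<dots> \<in> S" using step a'(1) by (intro S step.IH) auto
  finally show ?case .
qed

lemma conductor_mult:
  assumes "g \<in> conductor" "b \<in> B"
  shows "g * b \<in> conductor"
  using assms B_mult by (auto simp: conductor_def mult.assoc)

lemma conductor_subset: "(conductor :: 'r fract set) \<subseteq> range to_fract"
proof
  show "g \<in> range to_fract" if "g \<in> conductor" for g :: "'r fract"
    using that bspec[OF _ B_1, of "\<lambda>s. g * s \<in> range to_fract"] by (simp add: conductor_def)
qed

lemma exists_power_relation:
  assumes np: "\<And>\<tau>. M \<noteq> ideal_gen {\<tau>}" and C: "\<not> conductor \<subseteq> to_fract ` ideal_power M 2"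
  obtains x y e v where "x \<in> M" "y \<in> M" "x \<noteq> 0" "x ^ e = y ^ v" "e > 0" "v > 0"
    "y \<notin> ideal_power M 2" "\<And>c. x - \<iota> c * y \<notin> ideal_power M 2"
proof -
  have nB: "\<not> B \<subseteq> range to_fract" using maximal_ideal_principal np by blast
  obtain t e y where t: "uniformizer t" and e: "e > 0" and y: "y \<in> M" "to_fract y = t ^ e"
    and M_div: "\<And>r. r \<in> M \<Longrightarrow> divs (t ^ e) (to_fract r)" by (rule uniformizer_power_in_M) blast
  have tn: "t \<in> nil" and tB: "t \<in> B" using t nil_B by (auto simp: uniformizer_def)
  have unit1: "unitB 1" by (simp add: unitB_def B_1)
  have order: "m \<le> n" if "divs (t ^ m) (t ^ n)" for m n
    using uniformizer_order[OF t unit1, of m n] that by simp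
  define S where "S = to_fract ` ideal_power M 2"
  have S_add: "a + b \<in> S" if "a \<in> S" "b \<in> S" for a b
    using that unfolding S_def
    by (auto intro!: imageI idl.subspace_add[OF is_ideal_power] simp flip: to_fract_add)
  have S_scale: "to_fract r * a \<in> S" if "a \<in> S" for a r
    using that unfolding S_def
    by (auto intro!: imageI idl.subspace_scale[OF is_ideal_power] simp flip: to_fract_mult)
  have S_order: "e + e \<le> n" if "t ^ n \<in> S" for n
  proof -
    have "divs (t ^ e * t ^ e) (t ^ n)" using M_square_order[OF M_div] that unfolding S_def by auto
    then show ?thesis by (intro order) (simp add: power_add)
  qed

  obtain x' where x': "x' \<in> conductor" "x' \<notin> S" using C by (auto simp: S_def)
  have "0 \<in> S" unfolding S_def using idl.subspace_0[OF is_ideal_power] by (intro image_eqI[of _ _ 0]) auto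
  have fac: "\<exists>u n. unitB u \<and> g = u * t ^ n \<and> t ^ n \<in> conductor" if g: "g \<in> conductor" "g \<noteq> 0" for g
  proof -
    have "g \<in> B" using g conductor_subset B_base by blast
    then obtain u n where u: "unitB u" "g = u * t ^ n" by (rule uniformizer_factor[OF t _ g(2)])
    then have "t ^ n = g * inverse u" by (simp add: unitB_def)
    moreover have "g * inverse u \<in> conductor"
      by (rule conductor_mult[OF g(1)]) (use u in \<open>simp add: unitB_def\<close>)
    ultimately show ?thesis using u by metis
  qed
  obtain u1 n1 where "t ^ n1 \<in> conductor" using fac x' \<open>0 \<in> S\<close> by metis
  define c where "c = (LEAST n. t ^ n \<in> conductor)"
  have c: "t ^ c \<in> conductor" unfolding c_def by (rule LeastI) fact
  have c_le: "c \<le> n" if "t ^ n \<in> conductor" for n unfolding c_def by (rule Least_le) (rule that)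
  \<comment> \<open>For c = 0 the rings R and B would agree. Positivity puts the conductor into
    \<open>nil\<close>, hence into M.\<close>
  have c_pos: "c > 0"
  proof (rule ccontr)
    assume "\<not> c > 0"
    then have "(1 :: 'r fract) \<in> conductor" using c by simp
    then show False using nB by (auto simp: conductor_def)
  qed
  have cond: "t ^ j * a \<in> conductor" if "c \<le> j" "a \<in> B" for j a
  proof -
    have eq: "t ^ j * a = t ^ c * (t ^ (j - c) * a)" using that by (simp flip: power_add mult.assoc)
    show ?thesis unfolding eq by (intro conductor_mult[OF c] B_mult B_power tB that)
  qed
  have cond_M: "\<exists>r\<in>M. t ^ j * a = to_fract r" if "c \<le> j" "a \<in> B" for j a
  proof -
    have "t ^ j * a \<in> range to_fract" using cond[OF that] conductor_subset by blast
    then obtain r where r: "t ^ j * a = to_fract r" by blast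
    have "t ^ j * a = (t ^ (j - 1) * a) * t"
    proof -
      have "j = Suc (j - 1)" using that(1) c_pos by simp
      then have "t ^ j = t * t ^ (j - 1)" by (metis power_Suc)
      then show ?thesis by simp
    qed
    also have "\<dots> \<in> nil" by (intro nil_mult tn B_closed tB that)
    finally show ?thesis using r nil_M by auto
  qed
  have top: "t ^ (c + e) * a \<in> S" if a: "a \<in> B" for a
  proof -
    obtain r where r: "r \<in> M" "t ^ c * a = to_fract r" using cond_M[OF order_refl a] by blast
    have "y * r \<in> ideal_power M 2"
      unfolding ideal_power_2[OF M_ideal] using y r by (intro idl.span_base) blast
    moreover have "t ^ (c + e) * a = to_fract (y * r)"
      using r(2) y(2) by (simp add: power_add mult_ac)
    ultimately show ?thesis unfolding S_def by blast
  qed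
  define P where "P j \<longleftrightarrow> c \<le> j \<and> t ^ j \<notin> S" for j
  have "\<exists>j. P j"
  proof (rule ccontr)
    assume neg: "\<not> ?thesis"
    \<comment> \<open>If all t^j with j \<ge> c lay in M^2, descent from the exponent c + e would
      put the whole conductor there, including x'.\<close>
    have "t ^ c * a \<in> S" if "a \<in> B" for a
    proof (rule B_downward[OF t, where b = c and c = "c + e"])
      show "\<kappa> r * b \<in> S" if "b \<in> S" for b r using S_scale[OF that] by (simp add: \<kappa>_def)
      show "t ^ j \<in> S" if "c \<le> j" for j using neg that by (auto simp: P_def)
    qed (use S_add top that in auto)
    moreover obtain u n where u: "unitB u" "x' = u * t ^ n" "t ^ n \<in> conductor"
      using fac[OF x'(1)] x'(2) \<open>0 \<in> S\<close> by blast
    moreover have "x' = t ^ c * (u * t ^ (n - c))" using c_le[OF u(3)] u(2)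
      by (metis le_add_diff_inverse mult.left_commute power_add)
    ultimately show False using x'(2) B_mult B_power tB by (auto simp: unitB_def)
  qed
  then obtain j where j: "P j" by blast
  \<comment> \<open>Beyond c + e all powers of t lie in M^2, so a greatest exponent exists.\<close>
  have bound: "j \<le> c + e" if "P j" for j
  proof (rule ccontr)
    assume "\<not> ?thesis"
    then have "t ^ j = t ^ (c + e) * t ^ (j - (c + e))" by (simp flip: power_add)
    then show False using that top[OF B_power[OF tB]] by (simp add: P_def)
  qed
  define v where "v = (GREATEST j. P j)"
  have "P v" unfolding v_def by (rule GreatestI_nat[where P = P, OF j bound])
  then have v: "c \<le> v" "t ^ v \<notin> S" by (auto simp: P_def)
  have v_max: "t ^ i \<in> S" if "v < i" for i
  proof (rule ccontr)
    assume "t ^ i \<notin> S"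
    then have "P i" using that v(1) by (simp add: P_def)
    then have "i \<le> v" unfolding v_def by (rule Greatest_le_nat[where P = P, OF _ bound])
    then show False using that by simp
  qed
  obtain x where x: "x \<in> M" "t ^ v = to_fract x" using cond_M[OF v(1) B_1] by auto
  have "e \<le> v" using M_div[OF x(1)] unfolding x(2)[symmetric] by (rule order)
  \<comment> \<open>Maximality of v enters here: if e = v, then t^(e+1) lies in M^2 and has order at
    least 2 e, so e = 1. Then t itself lies in R, and descent from t^c B gives B inside R.\<close>
  moreover have "e \<noteq> v"
  proof
    assume "e = v"
    then have "e + e \<le> Suc e" by (intro S_order v_max) simp
    then have "e = 1" using e by simp
    then have ty: "t = to_fract y" using y by simp
    have "t ^ 0 * a \<in> range to_fract" if "a \<in> B" for a
    proof (rule B_downward[OF t, where b = 0 and c = c])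
      show "t ^ c * a \<in> range to_fract" if "a \<in> B" for a using cond[OF order_refl that] conductor_subset by blast
      show "t ^ j \<in> range to_fract" for j unfolding ty to_fract_power[symmetric] by (rule rangeI)
    qed (use that in \<open>auto intro: range_to_fract_closed simp: \<kappa>_def\<close>)
    then show False using nB by auto
  qed
  ultimately have ev: "e < v" by simp
  show ?thesis
  proof (rule that)
    show "x \<in> M" "y \<in> M" "e > 0" "v > 0" by (fact x y e)+ (use ev in simp)
    have "to_fract (x ^ e) = to_fract (y ^ v)"
      by (simp add: y(2) mult.commute flip: x(2) power_mult)
    then show "x ^ e = y ^ v" by (simp only: to_fract_eq_iff)
    have "to_fract x \<noteq> 0" unfolding x(2)[symmetric] using uniformizer_nonzero[OF t] by simp
    then show "x \<noteq> 0" by simp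
    show "y \<notin> ideal_power M 2"
    proof
      assume "y \<in> ideal_power M 2"
      then have "t ^ e \<in> S" unfolding y(2)[symmetric] S_def by blast
      then show False using S_order e by force
    qed
    show "x - \<iota> a * y \<notin> ideal_power M 2" for a
    proof
      assume mem: "x - \<iota> a * y \<in> ideal_power M 2"
      show False
      proof (cases "a = 0")
        case True
        then have "x \<in> ideal_power M 2" using mem by (simp add: \<iota>_simps)
        then show False using v(2) x(2) by (simp add: S_def)
      next
        case False
        \<comment> \<open>For nonzero a the order of x - a y is exactly e, whereas elements of M^2
          are divisible by t^(2e).\<close>
        have eq: "to_fract (x - \<iota> a * y) = t ^ v - \<kappa> a * t ^ e" using x(2) y(2) by (simp add: \<kappa>_def)
        have "divs (t ^ e * t ^ e) (t ^ v - \<kappa> a * t ^ e)"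
          using M_square_order[OF M_div mem] unfolding eq .
        moreover have "divs (t ^ Suc e) (t ^ e * t ^ e)"
          unfolding power_add[symmetric] using e by (intro divs_power_le tB) simp
        ultimately have "divs (t ^ Suc e) (t ^ v - \<kappa> a * t ^ e)" using divs_trans by blast
        moreover have "divs (t ^ Suc e) (t ^ v)" using ev by (intro divs_power_le tB) simp
        ultimately have "divs (t ^ Suc e) (t ^ v - (t ^ v - \<kappa> a * t ^ e))"
          by (rule divs_diff[rotated])
        then have "divs (t ^ Suc e) (\<kappa> a * t ^ e)" by (simp only: diff_diff_eq2 add_diff_cancel_left')
        then show False using uniformizer_order[OF t unitB_\<kappa>[OF False]] by fastforce
      qed
    qed
  qed
qed

end

theorem theorem3p1:
  fixes \<iota> :: "'k::{alg_closed_field, field_char_0} \<Rightarrow> 'r::idom"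
    and \<mm> :: "'r set"
    and \<phi> :: "('n::finite, 'k) mfps \<Rightarrow> 'r"
    and f :: "(('n, 'k) mfps) ^ 'm::finite"
  assumes "local_ring \<mm>"
    and "adically_complete \<mm>"
    and "krull_dim TYPE('r) = 1"
    and "has_residue_field \<iota> \<mm>"
    and "emb_dim \<mm> = CARD('n)"
    and "CARD('n) \<ge> 2"
    and "presentation \<iota> \<phi> f"
    and "ideal_gen (range (($) f)) \<subseteq> ideal_power (ideal_gen (range mfps_X)) 2"
    and "\<not> conductor \<subseteq> to_fract ` ideal_power \<mm> 2"
  shows "coker_torsion (jacobian \<phi> f) \<noteq> {coker_zero (jacobian \<phi> f)}"
proof -
  have emb: "emb_dim \<mm> \<le> 1" if "\<mm> = ideal_gen {\<tau>}" for \<tau>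
    unfolding emb_dim_def by (rule Least_le, rule exI[of _ "{\<tau>}"]) (simp add: that)
  \<comment> \<open>Non-principality is how the embedding dimension enters: it excludes R = B and,
    for \<open>\<tau> = 0\<close>, a zero maximal ideal.\<close>
  then have np: "\<mm> \<noteq> ideal_gen {\<tau>}" for \<tau> using assms(5,6) by force
  have \<mm>: "is_ideal \<mm>"
    using local_ring_maximal[OF assms(1)] by (simp add: maximal_ideal_def)
  then obtain y0 where y0: "y0 \<in> \<mm>" "y0 \<noteq> 0"
    using np[of 0] idl.subspace_0[OF \<mm>] by (auto simp: idl.span_singleton)
  \<comment> \<open>A conductor element outside the square of \<open>\<mm>\<close> is in particular
    nonzero and serves as \<open>x0\<close>.\<close>
  obtain q :: "'r fract" where q: "q \<in> conductor" "q \<notin> to_fract ` ideal_power \<mm> 2"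
    using assms(9) by blast
  have "q * 1 \<in> range to_fract"
    using q(1) integral_closure_base[of 1] unfolding conductor_def by auto
  then obtain x0 where x0: "q = to_fract x0" by auto
  have "x0 \<noteq> 0" using q(2) idl.subspace_0[OF is_ideal_power] unfolding x0 by blast
  then interpret analytic_branch \<iota> \<mm> x0 y0
    using assms(1-4) q(1) y0 by unfold_locales (auto simp: conductor_def x0)
  obtain x y e v where "x \<in> \<mm>" "y \<in> \<mm>" "x \<noteq> 0" "x ^ e = y ^ v" "e > 0" "v > 0"
    "y \<notin> ideal_power \<mm> 2" "\<And>c. x - \<iota> c * y \<notin> ideal_power \<mm> 2"
    by (rule exists_power_relation[OF np assms(9)]) blast
  then show ?thesis
    by (rule torsion_of_power_relation[OF assms(7,4) \<mm> assms(8)])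
qed

end
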